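(* Let $G$ be a $t$-regular planar bipartite multigraph, $t\geq 2$. Then $\chi'_{trans}(G)=2$; that is, all proper $t$-colorings of $G$ are Kempe-equivalent.
   Context: Multigraphs may have multiple edges but no loops. A proper $t$-coloring of $G$ is a map $E(G)\to\{1,\dots,t\}$ with adjacent (i.e., sharing an endpoint) distinct edges receiving distinct colors; $\chi'(G)$ is the chromatic index; $M(f,j)$ is the set of edges of color $j$. Two $t$-colorings differ by at most $n$ color classes if the number of colors $j$ with $M(f,j)\neq M(g,j)$ is at most $n$; proper $t$-colorings $f,g$ are $n$-equivalent if there is a sequence $f_0=f,\dots,f_k=g$ ($k\geq 1$) of proper $t$-colorings with consecutive ones differing by at most $n$ color classes. $2$-equivalence is called Kempe-equivalence. $\chi'_{trans}(G)$ is the minimum integer $n\geq 2$ such that any two proper $\chi'(G)$-colorings of $G$ are $n$-equivalent. *)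

theory Defs
  imports "HOL-Analysis.Analysis"
begin

text \<open>Finite undirected multigraphs: parallel edges are distinct edges with the same set of ends,
  and requiring two ends excludes loops.\<close>

record ('v, 'e) mgraph =
  mverts :: "'v set"
  medges :: "'e set"
  mends :: "'e \<Rightarrow> 'v set"

definition multigraph :: "('v, 'e) mgraph \<Rightarrow> bool" where
  "multigraph G \<longleftrightarrow> finite (mverts G) \<and> finite (medges G) \<and>
     (\<forall>e\<in>medges G. mends G e \<subseteq> mverts G \<and> card (mends G e) = 2)"

definition mdegree :: "('v, 'e) mgraph \<Rightarrow> 'v \<Rightarrow> nat" where
  "mdegree G v = card {e \<in> medges G. v \<in> mends G e}"

definition mregular :: "nat \<Rightarrow> ('v, 'e) mgraph \<Rightarrow> bool" where
  "mregular t G \<longleftrightarrow> (\<forall>v\<in>mverts G. mdegree G v = t)"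

definition mbipartite :: "('v, 'e) mgraph \<Rightarrow> bool" where
  "mbipartite G \<longleftrightarrow> (\<exists>X Y. X \<union> Y = mverts G \<and> X \<inter> Y = {} \<and>
     (\<forall>e\<in>medges G. \<exists>x\<in>X. \<exists>y\<in>Y. mends G e = {x, y}))"

text \<open>A drawing in the plane: \<open>p\<close> places the vertices at distinct points and \<open>c\<close> sends each edge to
  a simple arc joining the points of its two ends, meeting no other vertex point, and meeting any
  other edge only at common ends.\<close>

definition plane_drawing ::
  "('v, 'e) mgraph \<Rightarrow> ('v \<Rightarrow> complex) \<Rightarrow> ('e \<Rightarrow> real \<Rightarrow> complex) \<Rightarrow> bool" where
  "plane_drawing G p c \<longleftrightarrow> inj_on p (mverts G) \<and>
     (\<forall>e\<in>medges G. arc (c e) \<and> {pathstart (c e), pathfinish (c e)} = p ` mends G e \<and>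
        path_image (c e) \<inter> p ` mverts G = p ` mends G e) \<and>
     (\<forall>e\<in>medges G. \<forall>e'\<in>medges G. e \<noteq> e' \<longrightarrow>
        path_image (c e) \<inter> path_image (c e') = p ` (mends G e \<inter> mends G e'))"

definition mplanar :: "('v, 'e) mgraph \<Rightarrow> bool" where
  "mplanar G \<longleftrightarrow> (\<exists>p c. plane_drawing G p c)"

definition proper_coloring :: "('v, 'e) mgraph \<Rightarrow> nat \<Rightarrow> ('e \<Rightarrow> nat) \<Rightarrow> bool" where
  "proper_coloring G t f \<longleftrightarrow> f \<in> medges G \<rightarrow>\<^sub>E {1..t} \<and>
     (\<forall>e\<in>medges G. \<forall>e'\<in>medges G. e \<noteq> e' \<and> mends G e \<inter> mends G e' \<noteq> {} \<longrightarrow> f e \<noteq> f e')"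

definition chromatic_index :: "('v, 'e) mgraph \<Rightarrow> nat" where
  "chromatic_index G = (LEAST t. \<exists>f. proper_coloring G t f)"

definition color_class :: "('v, 'e) mgraph \<Rightarrow> ('e \<Rightarrow> nat) \<Rightarrow> nat \<Rightarrow> 'e set" where
  "color_class G f j = {e \<in> medges G. f e = j}"

definition differ_at_most ::
  "('v, 'e) mgraph \<Rightarrow> nat \<Rightarrow> nat \<Rightarrow> ('e \<Rightarrow> nat) \<Rightarrow> ('e \<Rightarrow> nat) \<Rightarrow> bool" where
  "differ_at_most G t n f g \<longleftrightarrow>
     card {j \<in> {1..t}. color_class G f j \<noteq> color_class G g j} \<le> n"

definition n_equivalent ::
  "('v, 'e) mgraph \<Rightarrow> nat \<Rightarrow> nat \<Rightarrow> ('e \<Rightarrow> nat) \<Rightarrow> ('e \<Rightarrow> nat) \<Rightarrow> bool" where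
  "n_equivalent G t n f g \<longleftrightarrow> (\<exists>(k::nat) F. k \<ge> 1 \<and> F 0 = f \<and> F k = g \<and>
     (\<forall>i\<le>k. proper_coloring G t (F i)) \<and>
     (\<forall>i<k. differ_at_most G t n (F i) (F (Suc i))))"

abbreviation Kempe_equivalent ::
  "('v, 'e) mgraph \<Rightarrow> nat \<Rightarrow> ('e \<Rightarrow> nat) \<Rightarrow> ('e \<Rightarrow> nat) \<Rightarrow> bool" where
  "Kempe_equivalent G t \<equiv> n_equivalent G t 2"

definition chi_trans :: "('v, 'e) mgraph \<Rightarrow> nat" where
  "chi_trans G = (LEAST n. n \<ge> 2 \<and>
     (\<forall>f g. proper_coloring G (chromatic_index G) f \<and> proper_coloring G (chromatic_index G) g
        \<longrightarrow> n_equivalent G (chromatic_index G) n f g))"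

end

theory Submission
  imports Defs "HOL-Complex_Analysis.Complex_Analysis"
begin

text \<open>
  Two independent facts are combined. First, in a regular bipartite multigraph any two proper
  colourings with the degree as number of colours are linked by steps that recolour at most three
  colour classes (Hall's theorem). Three colour classes span a cubic plane bipartite multigraph, so
  it remains to treat three colours.

  For a cubic plane bipartite multigraph, direct all edges from one side to the other and let
  \<open>w\<^sub>i\<^sub>j\<close> be the winding number function of the 1-cycle (edges of colour \<open>i\<close>) minus (edges of colour
  \<open>j\<close>). By the Jordan curve theorem \<open>w\<^sub>i\<^sub>j\<close> takes exactly two values \<open>m\<close>, \<open>m + 1\<close> next to each
  \<open>(i,j)\<close>-coloured Kempe cycle, and the third edge at a vertex of the cycle lies in the region of one
  of these two values; this is the cyclic order (turn) of the three colours at the vertex. Since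
  \<open>w\<^sub>i\<^sub>j + w\<^sub>j\<^sub>l + w\<^sub>l\<^sub>i = 0\<close>, the turn does not depend on the chosen pair. The function \<open>w\<^sub>i\<^sub>j\<close> is constant
  along an edge of the third colour, so the ends of this edge have different turns iff the levels \<open>m\<close>
  of the Kempe cycles at its ends have different parity. Swapping \<open>i\<close> and \<open>j\<close> on all Kempe cycles of
  odd level therefore repairs all edges of the third colour and leaves the status of the others
  unchanged. Once all turns agree along edges, a colouring is determined on each component up to a
  permutation of the colours.
\<close>

section \<open>Factorizations of bipartite multigraphs\<close>

text \<open>A drawing by arbitrary arcs offers no usable picture near a vertex: an arc may spiral
  into its end, so the cyclic order of the edges there has no direct definition. Winding numbers
  replace it, and they are read only where they can be controlled: at midpoints of edges, where a
  single edge passes, and at a vertex for a 1-cycle that vanishes on all edges there. Half an edge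
  connects the two kinds of points.

  The number three in the first reduction comes from exchanging edges one at a time: a would-be
  colour class is kept inside two classes, the next edge may bring in a third, and in the cubic
  multigraph of these three colours the complement of the would-be class still satisfies Hall's
  condition, in spite of the one vertex where the exchange left a gap. Three is also the degree at
  which a Kempe cycle leaves a single edge at each of its vertices, so that a turn is one bit.

  As every edge points from X to Y, equal turns at the two ends of an edge stand for opposite cyclic
  orders of the colours.\<close>

locale bigraph =
  fixes X Y :: "'v set" and E :: "'e set" and hx hy :: "'e \<Rightarrow> 'v"
  assumes finX: "finite X" and finY: "finite Y" and finE: "finite E"
    and disjXY: "X \<inter> Y = {}"
    and hx: "e \<in> E \<Longrightarrow> hx e \<in> X" and hy: "e \<in> E \<Longrightarrow> hy e \<in> Y"
begin

definition inc :: "'e \<Rightarrow> 'v \<Rightarrow> bool" where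
  "inc e v \<longleftrightarrow> hx e = v \<or> hy e = v"

lemma inc_X: "e \<in> E \<Longrightarrow> v \<in> X \<Longrightarrow> inc e v \<longleftrightarrow> hx e = v"
  using hy disjXY by (auto simp: inc_def)

lemma inc_Y: "e \<in> E \<Longrightarrow> v \<in> Y \<Longrightarrow> inc e v \<longleftrightarrow> hy e = v"
  using hx disjXY by (auto simp: inc_def)

lemma inc_hx [simp]: "inc e (hx e)" and inc_hy [simp]: "inc e (hy e)"
  by (auto simp: inc_def)

lemma inc_vertex: "e \<in> E \<Longrightarrow> inc e v \<Longrightarrow> v \<in> X \<union> Y"
  using hx hy by (auto simp: inc_def)

lemma hx_neq_hy: "e \<in> E \<Longrightarrow> hx e \<noteq> hy e"
  using hx hy disjXY by (metis disjoint_iff)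

text \<open>Exactly one edge of each colour at each vertex covers properness and regularity at once:
  by \<open>factorization_deg\<close> the degree is the number of colours. The edge set
  \<open>F\<close> is a parameter because the arguments pass to the edges of a few colours.\<close>

definition factorization :: "'e set \<Rightarrow> nat set \<Rightarrow> ('e \<Rightarrow> nat) \<Rightarrow> bool" where
  "factorization F C f \<longleftrightarrow> F \<subseteq> E \<and> f ` F \<subseteq> C \<and>
     (\<forall>v\<in>X \<union> Y. \<forall>c\<in>C. \<exists>!e. e \<in> F \<and> inc e v \<and> f e = c)"

lemma factorization_ex1:
  "factorization F C f \<Longrightarrow> v \<in> X \<union> Y \<Longrightarrow> c \<in> C \<Longrightarrow> \<exists>!e. e \<in> F \<and> inc e v \<and> f e = c"
  unfolding factorization_def by blast

lemma factorization_edge: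
  assumes "factorization F C f" "v \<in> X \<union> Y" "c \<in> C"
  obtains e where "e \<in> F" "e \<in> E" "inc e v" "f e = c"
    "\<forall>e'\<in>F. inc e' v \<longrightarrow> f e' = c \<longrightarrow> e' = e"
  using assms unfolding factorization_def by (metis subsetD)

lemma factorization_inj:
  assumes "factorization F C f" "e \<in> F" "e' \<in> F" "inc e v" "inc e' v" "f e = f e'"
  shows "e = e'"
proof -
  have "v \<in> X \<union> Y" "f e \<in> C"
    using assms inc_vertex by (auto simp: factorization_def)
  then show ?thesis
    using assms unfolding factorization_def by metis
qed

text \<open>With every edge directed from X to Y, all edges at a vertex enter the boundary there
  with the same sign, so a vanishing boundary is a vanishing plain sum.\<close>

definition cycle_chain :: "('e \<Rightarrow> int) \<Rightarrow> bool" where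
  "cycle_chain k \<longleftrightarrow> (\<forall>v\<in>X \<union> Y. (\<Sum>e | e \<in> E \<and> inc e v. k e) = 0)"

lemma cycle_chain_diff:
  "cycle_chain k \<Longrightarrow> cycle_chain l \<Longrightarrow> cycle_chain (\<lambda>e. k e - l e)"
  by (simp add: cycle_chain_def sum_subtractf)

text \<open>Along colour \<open>i\<close> and against colour \<open>j\<close>: the colours alternate
  and edges point from X to Y, so this runs through every Kempe cycle in one sense.\<close>

definition colour_chain :: "'e set \<Rightarrow> ('e \<Rightarrow> nat) \<Rightarrow> nat \<Rightarrow> nat \<Rightarrow> 'e \<Rightarrow> int" where
  "colour_chain F f i j e = (if e \<in> F \<and> f e = i then 1 else 0) - (if e \<in> F \<and> f e = j then 1 else 0)"

lemma sum_colour_class_at: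
  assumes "factorization F C f" "v \<in> X \<union> Y" "c \<in> C"
  shows "(\<Sum>e | e \<in> E \<and> inc e v. if e \<in> F \<and> f e = c then 1 else 0 :: int) = 1"
proof -
  obtain e where e: "e \<in> F" "e \<in> E" "inc e v" "f e = c"
    "\<forall>e'\<in>F. inc e' v \<longrightarrow> f e' = c \<longrightarrow> e' = e"
    by (rule factorization_edge[OF assms])
  have "(e' \<in> F \<and> f e' = c) = (e' = e)" if "e' \<in> {e. e \<in> E \<and> inc e v}" for e'
    using e that by blast
  then have "(\<Sum>e | e \<in> E \<and> inc e v. if e \<in> F \<and> f e = c then 1 else 0 :: int)
      = (\<Sum>e' | e' \<in> E \<and> inc e' v. if e' = e then 1 else 0)"
    by (intro sum.cong refl) presburger
  also have "\<dots> = 1"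
    using e(2,3) finE by simp
  finally show ?thesis .
qed

lemma cycle_chain_colour_chain:
  assumes "factorization F C f" "i \<in> C" "j \<in> C"
  shows "cycle_chain (colour_chain F f i j)"
  unfolding cycle_chain_def colour_chain_def
  using sum_colour_class_at[OF assms(1) _ assms(2)] sum_colour_class_at[OF assms(1) _ assms(3)]
  by (simp add: sum_subtractf)

text \<open>A step counts changed colour classes, not changed cycles. Functions are fixed outside
  \<open>F\<close>, so that a step on the edges of some colours is literally a step on all edges
  (\<open>steps_lift\<close>).\<close>

definition step :: "nat \<Rightarrow> 'e set \<Rightarrow> nat set \<Rightarrow> ('e \<Rightarrow> nat) \<Rightarrow> ('e \<Rightarrow> nat) \<Rightarrow> bool" where
  "step n F C f g \<longleftrightarrow> factorization F C f \<and> factorization F C g \<and> (\<forall>e. e \<notin> F \<longrightarrow> g e = f e) \<and>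
     (\<exists>S\<subseteq>C. finite S \<and> card S \<le> n \<and> (\<forall>e\<in>F. f e \<notin> S \<or> g e \<notin> S \<longrightarrow> g e = f e))"

lemma step_sym: "step n F C f g \<Longrightarrow> step n F C g f"
  unfolding step_def by metis

lemma steps_sym: "(step n F C)\<^sup>*\<^sup>* f g \<Longrightarrow> (step n F C)\<^sup>*\<^sup>* g f"
  using step_sym by (metis symp_rtranclp sympI sympD)

lemma steps_factorization:
  "(step n F C)\<^sup>*\<^sup>* f g \<Longrightarrow> factorization F C f \<Longrightarrow> factorization F C g"
  by (induction rule: rtranclp_induct) (auto simp: step_def)

lemma steps_outside:
  "(step n F C)\<^sup>*\<^sup>* f g \<Longrightarrow> e \<notin> F \<Longrightarrow> g e = f e"
  by (induction rule: rtranclp_induct) (auto simp: step_def)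

text \<open>The region is a vertex set. If no \<open>i\<close>- or \<open>j\<close>-edge leaves
  \<open>T\<close>, its vertices form a union of Kempe cycles and testing \<open>hx e\<close> alone
  is unambiguous; edges of other colours may cross the border because the transposition fixes
  them.\<close>

definition Kempe_swap :: "'e set \<Rightarrow> nat \<Rightarrow> nat \<Rightarrow> 'v set \<Rightarrow> ('e \<Rightarrow> nat) \<Rightarrow> 'e \<Rightarrow> nat" where
  "Kempe_swap F i j T f e = (if e \<in> F \<and> hx e \<in> T then Transposition.transpose i j (f e) else f e)"

lemma Kempe_swap_at:
  assumes T: "\<And>e. e \<in> F \<Longrightarrow> f e \<in> {i, j} \<Longrightarrow> hx e \<in> T \<longleftrightarrow> hy e \<in> T"
    and e: "e \<in> F" "inc e v"
  shows "Kempe_swap F i j T f e = (if v \<in> T then Transposition.transpose i j (f e) else f e)"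
proof (cases "f e \<in> {i, j}")
  case True
  then have "hx e \<in> T \<longleftrightarrow> v \<in> T" using T[OF e(1)] e(2) by (auto simp: inc_def)
  then show ?thesis using e by (simp add: Kempe_swap_def)
next
  case False
  then have "Transposition.transpose i j (f e) = f e" by (simp add: Transposition.transpose_def)
  then show ?thesis by (simp add: Kempe_swap_def)
qed

lemma factorization_Kempe_swap:
  assumes f: "factorization F C f" and ij: "i \<in> C" "j \<in> C"
    and T: "\<And>e. e \<in> F \<Longrightarrow> f e \<in> {i, j} \<Longrightarrow> hx e \<in> T \<longleftrightarrow> hy e \<in> T"
  shows "factorization F C (Kempe_swap F i j T f)"
  unfolding factorization_def
proof (intro conjI ballI)
  have tr: "Transposition.transpose i j c \<in> C" if "c \<in> C" for c
    using that ij by (simp add: Transposition.transpose_def)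
  show "F \<subseteq> E" using f by (simp add: factorization_def)
  show "Kempe_swap F i j T f ` F \<subseteq> C"
    using f tr by (auto simp: factorization_def Kempe_swap_def)
  fix v c assume v: "v \<in> X \<union> Y" and c: "c \<in> C"
  define c' where "c' = (if v \<in> T then Transposition.transpose i j c else c)"
  have "c' \<in> C" using c tr by (simp add: c'_def)
  then have "\<exists>!e. e \<in> F \<and> inc e v \<and> f e = c'"
    using f v by (auto simp: factorization_def)
  moreover have "(e \<in> F \<and> inc e v \<and> Kempe_swap F i j T f e = c) \<longleftrightarrow> (e \<in> F \<and> inc e v \<and> f e = c')" for e
  proof (cases "e \<in> F \<and> inc e v")
    case True
    then have "Kempe_swap F i j T f e = (if v \<in> T then Transposition.transpose i j (f e) else f e)"
      using Kempe_swap_at[OF T] by blast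
    then show ?thesis
      using True by (auto simp: c'_def)
  qed auto
  ultimately show "\<exists>!e. e \<in> F \<and> inc e v \<and> Kempe_swap F i j T f e = c" by simp
qed

text \<open>Only the classes of \<open>i\<close> and \<open>j\<close> change, however many Kempe
  cycles \<open>T\<close> contains; a simultaneous swap is still one step.\<close>

lemma step_Kempe_swap:
  assumes f: "factorization F C f" and ij: "i \<in> C" "j \<in> C"
    and T: "\<And>e. e \<in> F \<Longrightarrow> f e \<in> {i, j} \<Longrightarrow> hx e \<in> T \<longleftrightarrow> hy e \<in> T"
  shows "step 2 F C f (Kempe_swap F i j T f)"
  unfolding step_def
proof (intro conjI)
  show "factorization F C (Kempe_swap F i j T f)" by (rule factorization_Kempe_swap[OF f ij T])
  have "Kempe_swap F i j T f e = f e" if "f e \<notin> {i, j} \<or> Kempe_swap F i j T f e \<notin> {i, j}" for e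
    using that by (auto simp: Kempe_swap_def Transposition.transpose_def split: if_splits)
  moreover have "card {i, j} \<le> 2" by (simp add: card_insert_if)
  ultimately show "\<exists>S\<subseteq>C. finite S \<and> card S \<le> 2 \<and>
      (\<forall>e\<in>F. f e \<notin> S \<or> Kempe_swap F i j T f e \<notin> S \<longrightarrow> Kempe_swap F i j T f e = f e)"
    using ij by (intro exI[of _ "{i, j}"]) auto
qed (use f in \<open>auto simp: Kempe_swap_def\<close>)

end

section \<open>Regular bipartite multigraphs: recolouring three classes at a time\<close>

text \<open>Induction after Halmos and Vaughan. A proper nonempty set \<open>J\<close> with equality
  splits the problem into \<open>J\<close> and the rest without the neighbours of \<open>J\<close>;
  if there is none, every proper nonempty set has a neighbour to spare, and an arbitrary first
  choice does no harm.\<close>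

theorem Hall_marriage:
  assumes "finite I" "\<And>i. i \<in> I \<Longrightarrow> finite (A i)"
    and "\<And>J. J \<subseteq> I \<Longrightarrow> card J \<le> card (\<Union>i\<in>J. A i)"
  shows "\<exists>r. inj_on r I \<and> (\<forall>i\<in>I. r i \<in> A i)"
  using assms
proof (induction "card I" arbitrary: I A rule: less_induct)
  case less
  note fin = less.prems(1,2) and hall = less.prems(3)
  have finU: "finite (\<Union>i\<in>J. A i)" if "J \<subseteq> I" for J
    using that fin finite_subset[OF that fin(1)] by blast
  show ?case
  proof (cases "\<exists>J. J \<subset> I \<and> J \<noteq> {} \<and> card J = card (\<Union>i\<in>J. A i)")
    case True
    then obtain J where J: "J \<subset> I" "J \<noteq> {}" "card J = card (\<Union>i\<in>J. A i)" by blast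
    have finJ: "finite J" using J fin finite_subset by blast
    define U where "U = (\<Union>i\<in>J. A i)"
    have finU': "finite U" unfolding U_def using J finU by blast
    have "\<exists>r. inj_on r J \<and> (\<forall>i\<in>J. r i \<in> A i)"
    proof (rule less.hyps)
      show "card J < card I" using J fin by (intro psubset_card_mono)
      show "finite J" by fact
      show "finite (A i)" if "i \<in> J" for i using that J fin by blast
      show "card K \<le> card (\<Union>i\<in>K. A i)" if "K \<subseteq> J" for K
        using hall[of K] that J by blast
    qed
    then obtain r where r: "inj_on r J" "\<And>i. i \<in> J \<Longrightarrow> r i \<in> A i" by blast
    have "\<exists>s. inj_on s (I - J) \<and> (\<forall>i\<in>I - J. s i \<in> A i - U)"
    proof (rule less.hyps)
      show "card (I - J) < card I" using J fin by (intro psubset_card_mono) auto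
      show "finite (I - J)" using fin by blast
      show "finite (A i - U)" if "i \<in> I - J" for i using that fin by blast
      show "card K \<le> card (\<Union>i\<in>K. A i - U)" if K: "K \<subseteq> I - J" for K
      proof -
        have fK: "finite K" using K fin finite_subset by blast
        \<comment> \<open>Hall's condition for \<open>K \<union> J\<close> minus the equality for
          \<open>J\<close> is the condition for \<open>K\<close> outside \<open>U\<close>.\<close>
        have eq: "(\<Union>i\<in>K. A i - U) = (\<Union>i\<in>K \<union> J. A i) - U" by (auto simp: U_def)
        have "card K + card J = card (K \<union> J)"
          using K fK finJ by (intro card_Un_disjoint[symmetric]) auto
        also have "\<dots> \<le> card (\<Union>i\<in>K \<union> J. A i)" using K J by (intro hall) blast
        finally have "card K \<le> card (\<Union>i\<in>K \<union> J. A i) - card U"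
          using J(3) unfolding U_def by linarith
        also have "\<dots> = card ((\<Union>i\<in>K \<union> J. A i) - U)"
          using finU' by (intro card_Diff_subset[symmetric]) (auto simp: U_def)
        finally show ?thesis using eq by simp
      qed
    qed
    then obtain s where s: "inj_on s (I - J)" "\<And>i. i \<in> I - J \<Longrightarrow> s i \<in> A i - U" by blast
    define t where "t i = (if i \<in> J then r i else s i)" for i
    have "inj_on t I"
    proof (rule inj_onI)
      fix i i' assume ii: "i \<in> I" "i' \<in> I" "t i = t i'"
      have "r k \<in> U" if "k \<in> J" for k using r(2) that by (auto simp: U_def)
      from this[of i] this[of i'] show "i = i'"
        using ii inj_onD[OF r(1), of i i'] inj_onD[OF s(1), of i i'] s(2)[of i] s(2)[of i']
        by (cases "i \<in> J"; cases "i' \<in> J") (auto simp: t_def)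
    qed
    moreover have "\<forall>i\<in>I. t i \<in> A i" using r(2) s(2) by (simp add: t_def)
    ultimately show ?thesis by blast
  next
    case False
    show ?thesis
    proof (cases "I = {}")
      case False
      then obtain i where i: "i \<in> I" by blast
      have "card {i} \<le> card (\<Union>k\<in>{i}. A k)" using hall[of "{i}"] i by blast
      then have "A i \<noteq> {}" by auto
      then obtain a where a: "a \<in> A i" by blast
      have "\<exists>s. inj_on s (I - {i}) \<and> (\<forall>k\<in>I - {i}. s k \<in> A k - {a})"
      proof (rule less.hyps)
        show "card (I - {i}) < card I" using i fin by (intro psubset_card_mono) auto
        show "finite (I - {i})" using fin by blast
        show "finite (A k - {a})" if "k \<in> I - {i}" for k using that fin by blast
        show "card K \<le> card (\<Union>k\<in>K. A k - {a})" if K: "K \<subseteq> I - {i}" for K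
        proof (cases "K = {}")
          case False
          have "K \<subset> I" using K i by blast
          then have "card K < card (\<Union>k\<in>K. A k)"
            using False \<open>\<not> (\<exists>J. J \<subset> I \<and> J \<noteq> {} \<and> card J = card (\<Union>i\<in>J. A i))\<close> hall[of K]
            by (metis le_neq_implies_less psubset_imp_subset)
          then have "card K \<le> card (\<Union>k\<in>K. A k) - 1" by linarith
          also have "\<dots> \<le> card ((\<Union>k\<in>K. A k) - {a})" using diff_card_le_card_Diff[of "{a}" "\<Union>k\<in>K. A k"] by simp
          also have "(\<Union>k\<in>K. A k) - {a} = (\<Union>k\<in>K. A k - {a})" by blast
          finally show ?thesis .
        qed simp
      qed
      then obtain s where s: "inj_on s (I - {i})" "\<And>k. k \<in> I - {i} \<Longrightarrow> s k \<in> A k - {a}" by blast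
      have "inj_on (s(i := a)) I"
        using s by (auto simp: inj_on_def)
      moreover have "\<forall>k\<in>I. (s(i := a)) k \<in> A k" using s(2) a by auto
      ultimately show ?thesis by blast
    qed simp
  qed
qed

context bigraph begin

section \<open>Degrees, perfect matchings and 1-factorizations\<close>

definition deg :: "'e set \<Rightarrow> 'v \<Rightarrow> nat" where
  "deg F v = card {e \<in> F. inc e v}"

lemma fin_at: "F \<subseteq> E \<Longrightarrow> finite {e \<in> F. inc e v}"
  using finE finite_subset by (metis (no_types, lifting) mem_Collect_eq subset_iff)

lemma deg_eq_1_iff: "deg F v = 1 \<longleftrightarrow> (\<exists>!e. e \<in> F \<and> inc e v)"
proof -
  have "deg F v = 1 \<longleftrightarrow> (\<exists>e. {e \<in> F. inc e v} = {e})"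
    unfolding deg_def by (simp add: card_1_singleton_iff)
  also have "\<dots> \<longleftrightarrow> (\<exists>!e. e \<in> F \<and> inc e v)"
    unfolding Ex1_def by (intro ex_cong1) blast
  finally show ?thesis .
qed

lemma deg_Diff:
  assumes "M \<subseteq> F" "F \<subseteq> E"
  shows "deg (F - M) v = deg F v - deg M v"
proof -
  have "{e \<in> F - M. inc e v} = {e \<in> F. inc e v} - {e \<in> M. inc e v}" by blast
  then show ?thesis
    unfolding deg_def using assms fin_at[of M v] by (simp add: card_Diff_subset Collect_mono_iff subset_iff)
qed

lemma deg_exchange:
  assumes "P \<subseteq> E" "e \<notin> P" "e' \<in> P"
  shows "deg (insert e (P - {e'})) v + of_bool (inc e' v) = deg P v + of_bool (inc e v)"
proof -
  have fin: "finite {x \<in> P. inc x v}" using fin_at[OF assms(1)] .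
  have "deg (P - {e'}) v + of_bool (inc e' v) = deg P v"
  proof (cases "inc e' v")
    case True
    then have "{x \<in> P. inc x v} = insert e' {x \<in> P - {e'}. inc x v}" using assms by blast
    then show ?thesis unfolding deg_def using fin True by simp
  next
    case False
    then have "{x \<in> P. inc x v} = {x \<in> P - {e'}. inc x v}" by blast
    then show ?thesis unfolding deg_def using False by simp
  qed
  moreover have "deg (insert e (P - {e'})) v = deg (P - {e'}) v + of_bool (inc e v)"
  proof (cases "inc e v")
    case True
    then have "{x \<in> insert e (P - {e'}). inc x v} = insert e {x \<in> P - {e'}. inc x v}" by blast
    moreover have "finite {x \<in> P - {e'}. inc x v}" using fin by (rule rev_finite_subset) blast
    ultimately show ?thesis unfolding deg_def using True assms by simp
  next
    case False
    then have "{x \<in> insert e (P - {e'}). inc x v} = {x \<in> P - {e'}. inc x v}" by blast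
    then show ?thesis unfolding deg_def using False by simp
  qed
  ultimately show ?thesis by simp
qed

lemma sum_deg_X:
  assumes "F \<subseteq> E" "U \<subseteq> X"
  shows "(\<Sum>x\<in>U. deg F x) = card {e \<in> F. hx e \<in> U}"
proof -
  have finF: "finite F" "finite U" using assms finE finX finite_subset by blast+
  have "(\<Sum>x\<in>U. deg F x) = (\<Sum>x\<in>U. \<Sum>e | e \<in> {e \<in> F. hx e \<in> U} \<and> hx e = x. 1)"
  proof (rule sum.cong[OF refl])
    fix x assume "x \<in> U"
    then have "{e \<in> F. inc e x} = {e \<in> {e \<in> F. hx e \<in> U}. hx e = x}"
      using assms inc_X by blast
    then show "deg F x = (\<Sum>e | e \<in> {e \<in> F. hx e \<in> U} \<and> hx e = x. 1)"
      unfolding deg_def by simp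
  qed
  also have "\<dots> = (\<Sum>e\<in>{e \<in> F. hx e \<in> U}. 1)"
    using finF by (intro sum.group) auto
  finally show ?thesis by simp
qed

lemma sum_deg_Y:
  assumes "F \<subseteq> E" "U \<subseteq> Y"
  shows "(\<Sum>y\<in>U. deg F y) = card {e \<in> F. hy e \<in> U}"
proof -
  have finF: "finite F" "finite U" using assms finE finY finite_subset by blast+
  have "(\<Sum>y\<in>U. deg F y) = (\<Sum>y\<in>U. \<Sum>e | e \<in> {e \<in> F. hy e \<in> U} \<and> hy e = y. 1)"
  proof (rule sum.cong[OF refl])
    fix y assume "y \<in> U"
    then have "{e \<in> F. inc e y} = {e \<in> {e \<in> F. hy e \<in> U}. hy e = y}"
      using assms inc_Y by blast
    then show "deg F y = (\<Sum>e | e \<in> {e \<in> F. hy e \<in> U} \<and> hy e = y. 1)"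
      unfolding deg_def by simp
  qed
  also have "\<dots> = (\<Sum>e\<in>{e \<in> F. hy e \<in> U}. 1)"
    using finF by (intro sum.group) auto
  finally show ?thesis by simp
qed

lemma regular_card_eq:
  assumes F: "F \<subseteq> E" and deg: "\<And>v. v \<in> X \<union> Y \<Longrightarrow> deg F v = d" and d: "d > 0"
  shows "card X = card Y"
proof -
  have "{e \<in> F. hx e \<in> X} = F" "{e \<in> F. hy e \<in> Y} = F" using F hx hy by blast+
  then have "(\<Sum>x\<in>X. deg F x) = (\<Sum>y\<in>Y. deg F y)"
    using sum_deg_X[OF F order_refl] sum_deg_Y[OF F order_refl] by simp
  moreover have "(\<Sum>x\<in>X. deg F x) = card X * d" "(\<Sum>y\<in>Y. deg F y) = card Y * d"
    using deg by simp_all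
  ultimately show ?thesis using d by simp
qed

text \<open>Allowing one vertex of too large degree keeps Hall's condition, by integrality.\<close>

lemma perfect_matching_exists:
  assumes F: "F \<subseteq> E" and XY: "card X = card Y" and d: "d > 0"
    and degY: "\<And>y. y \<in> Y \<Longrightarrow> d \<le> deg F y"
    and degX: "\<And>x. x \<in> X \<Longrightarrow> x \<noteq> x' \<Longrightarrow> deg F x \<le> d" and degx': "deg F x' < 2 * d"
  shows "\<exists>M\<subseteq>F. \<forall>v\<in>X \<union> Y. deg M v = 1"
proof -
  define A where "A y = hx ` {e \<in> F. hy e = y}" for y
  have finF: "finite F" using F finE finite_subset by blast
  \<comment> \<open>The matching is sought from Y, so that the exceptional vertex \<open>x'\<close>
    is a neighbour and its excess, at most \<open>d - 1\<close>, enters the count only once.\<close>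
  have "\<exists>r. inj_on r Y \<and> (\<forall>y\<in>Y. r y \<in> A y)"
  proof (rule Hall_marriage[OF finY])
    show "finite (A y)" for y using finF by (simp add: A_def)
    fix J assume J: "J \<subseteq> Y"
    define U where "U = (\<Union>y\<in>J. A y)"
    have U: "U \<subseteq> X" "finite U" using F hx finX finite_subset[of U X] by (auto simp: U_def A_def)
    have "d * card J \<le> (\<Sum>y\<in>J. deg F y)"
      using sum_bounded_below[of J d "deg F"] J degY by (auto simp: mult.commute)
    also have "\<dots> = card {e \<in> F. hy e \<in> J}" by (rule sum_deg_Y[OF F J])
    also have "\<dots> \<le> card {e \<in> F. hx e \<in> U}"
      using finF by (intro card_mono) (auto simp: U_def A_def)
    also have "\<dots> = (\<Sum>x\<in>U. deg F x)" by (rule sum_deg_X[OF F U(1), symmetric])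
    also have "\<dots> \<le> (\<Sum>x\<in>U. d + (if x = x' then d - 1 else 0))"
      using U degX degx' by (intro sum_mono) auto
    also have "\<dots> \<le> d * card U + (d - 1)"
      using U(2) by (simp add: sum.distrib mult.commute)
    also have "\<dots> < d * (card U + 1)" using d by simp
    finally have "card J < card U + 1" using d by (simp only: nat_mult_less_cancel1)
    then show "card J \<le> card (\<Union>y\<in>J. A y)" by (simp add: U_def)
  qed
  then obtain r where r: "inj_on r Y" "\<And>y. y \<in> Y \<Longrightarrow> r y \<in> A y" by blast
  have "A y \<subseteq> X" for y using F hx by (auto simp: A_def)
  then have "r ` Y \<subseteq> X" using r(2) by blast
  then have rX: "r ` Y = X"
    using card_image[OF r(1)] XY finX by (intro card_subset_eq) auto
  have "\<exists>e. e \<in> F \<and> hy e = y \<and> hx e = r y" if "y \<in> Y" for y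
    using r(2)[OF that] by (auto simp: A_def)
  then obtain en where en: "\<And>y. y \<in> Y \<Longrightarrow> en y \<in> F \<and> hy (en y) = y \<and> hx (en y) = r y" by metis
  define M where "M = en ` Y"
  have MF: "M \<subseteq> F" using en by (auto simp: M_def)
  have "deg M v = 1" if v: "v \<in> X \<union> Y" for v
    unfolding deg_eq_1_iff
  proof (cases "v \<in> Y")
    case True
    have "e = en v" if e: "e \<in> M" "inc e v" for e
    proof -
      obtain y where y: "y \<in> Y" "e = en y" using e by (auto simp: M_def)
      moreover have "hy e = v" using inc_Y[of e v] e MF F True by blast
      ultimately show ?thesis using en by auto
    qed
    moreover have "en v \<in> M" "inc (en v) v" using True en[OF True] by (auto simp: M_def inc_def)
    ultimately show "\<exists>!e. e \<in> M \<and> inc e v" by blast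
  next
    case False
    then have vX: "v \<in> X" using v by blast
    then obtain y where y: "y \<in> Y" "r y = v" using rX by blast
    have "e = en y" if e: "e \<in> M" "inc e v" for e
    proof -
      obtain w where w: "w \<in> Y" "e = en w" using e by (auto simp: M_def)
      moreover have "hx e = v" using inc_X[of e v] e MF F vX by blast
      ultimately have "r w = r y" using en y by auto
      then show ?thesis using inj_onD[OF r(1)] w y by blast
    qed
    moreover have "en y \<in> M" "inc (en y) v" using y en[OF y(1)] by (auto simp: M_def inc_def)
    ultimately show "\<exists>!e. e \<in> M \<and> inc e v" by blast
  qed
  then show ?thesis using MF by blast
qed

lemma factorization_insert:
  assumes f: "factorization (F - M) D f" and M: "M \<subseteq> F" "F \<subseteq> E" "\<And>v. v \<in> X \<union> Y \<Longrightarrow> deg M v = 1"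
    and c: "c \<notin> D"
  shows "factorization F (insert c D) (\<lambda>e. if e \<in> M then c else f e)"
  unfolding factorization_def
proof (intro conjI ballI)
  let ?g = "\<lambda>e. if e \<in> M then c else f e"
  show "F \<subseteq> E" by fact
  have fD: "f e \<in> D" if "e \<in> F - M" for e using f that by (auto simp: factorization_def)
  then show "?g ` F \<subseteq> insert c D" by auto
  fix v b assume v: "v \<in> X \<union> Y" and b: "b \<in> insert c D"
  show "\<exists>!e. e \<in> F \<and> inc e v \<and> ?g e = b"
  proof (cases "b = c")
    case True
    then have "e \<in> F \<and> inc e v \<and> ?g e = b \<longleftrightarrow> e \<in> M \<and> inc e v" for e
      using fD[of e] c M(1) by auto
    moreover have "\<exists>!e. e \<in> M \<and> inc e v" using M(3)[OF v] by (simp only: deg_eq_1_iff)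
    ultimately show ?thesis by simp
  next
    case False
    then have "e \<in> F \<and> inc e v \<and> ?g e = b \<longleftrightarrow> e \<in> F - M \<and> inc e v \<and> f e = b" for e
      by auto
    moreover have "\<exists>!e. e \<in> F - M \<and> inc e v \<and> f e = b"
      using f v b False unfolding factorization_def by blast
    ultimately show ?thesis by simp
  qed
qed

text \<open>Koenig's theorem for regular bipartite multigraphs, by peeling off perfect matchings.
  Besides the existence of colourings it gives the freedom to recolour several classes at will once
  one of them is prescribed.\<close>

theorem regular_factorization_exists:
  assumes "finite D" "F \<subseteq> E" "\<And>v. v \<in> X \<union> Y \<Longrightarrow> deg F v = card D"
  shows "\<exists>f. factorization F D f"
  using assms
proof (induction D arbitrary: F rule: finite_induct)
  case empty
  have "F = {}"
  proof (rule ccontr)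
    assume "F \<noteq> {}"
    then obtain e where e: "e \<in> F" by blast
    then have "deg F (hx e) = 0" using empty hx by auto
    then have "{e' \<in> F. inc e' (hx e)} = {}" using fin_at[OF empty(1)] by (simp add: deg_def)
    then show False using e inc_hx[of e] by blast
  qed
  then show ?case by (simp add: factorization_def)
next
  case (insert c D)
  have d: "card (insert c D) > 0" "card (insert c D) = Suc (card D)" using insert.hyps by auto
  have XY: "card X = card Y" using regular_card_eq[OF insert.prems d(1)] .
  have "\<exists>M\<subseteq>F. \<forall>v\<in>X \<union> Y. deg M v = 1"
  proof (cases "X = {}")
    case True
    then have "Y = {}" using XY finY by simp
    then show ?thesis using True by blast
  next
    case False
    then obtain x where "x \<in> X" by blast
    then show ?thesis
      using insert.prems d(1) by (intro perfect_matching_exists[OF insert.prems(1) XY d(1), of x]) auto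
  qed
  then obtain M where M: "M \<subseteq> F" "\<And>v. v \<in> X \<union> Y \<Longrightarrow> deg M v = 1" by blast
  have "deg (F - M) v = card D" if "v \<in> X \<union> Y" for v
    using deg_Diff[OF M(1) insert.prems(1)] M(2)[OF that] insert.prems(2)[OF that] d(2) by simp
  then obtain f where "factorization (F - M) D f"
    using insert.IH[of "F - M"] insert.prems(1) by blast
  then show ?case
    using factorization_insert[OF _ M(1) insert.prems(1) M(2) insert.hyps(2)] by blast
qed

lemma factorization_deg:
  assumes f: "factorization F C f" and v: "v \<in> X \<union> Y"
  shows "deg F v = card C"
proof -
  have "inj_on f {e \<in> F. inc e v}"
    using factorization_inj[OF f] by (auto simp: inj_on_def)
  moreover have "f ` {e \<in> F. inc e v} = C"
  proof
    show "f ` {e \<in> F. inc e v} \<subseteq> C" using f by (auto simp: factorization_def)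
    show "C \<subseteq> f ` {e \<in> F. inc e v}"
    proof
      fix c assume "c \<in> C"
      then obtain e where "e \<in> F" "inc e v" "f e = c" using factorization_edge[OF f v] by blast
      then show "c \<in> f ` {e \<in> F. inc e v}" by blast
    qed
  qed
  ultimately show ?thesis unfolding deg_def by (metis card_image)
qed

section \<open>Recolouring inside a set of colours\<close>

lemma factorization_restrict:
  assumes f: "factorization F C f" and "S \<subseteq> C"
  shows "factorization {e \<in> F. f e \<in> S} S f"
  unfolding factorization_def
proof (intro conjI ballI)
  show "{e \<in> F. f e \<in> S} \<subseteq> E" "f ` {e \<in> F. f e \<in> S} \<subseteq> S" using f by (auto simp: factorization_def)
  fix v c assume "v \<in> X \<union> Y" "c \<in> S"
  then have "\<exists>!e. e \<in> F \<and> inc e v \<and> f e = c" using factorization_ex1[OF f] assms(2) by blast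
  moreover have "e \<in> F \<and> inc e v \<and> f e = c \<longleftrightarrow> e \<in> {e \<in> F. f e \<in> S} \<and> inc e v \<and> f e = c" for e
    using \<open>c \<in> S\<close> by blast
  ultimately show "\<exists>!e. e \<in> {e \<in> F. f e \<in> S} \<and> inc e v \<and> f e = c" by simp
qed

lemma factorization_patch:
  assumes f: "factorization F C f" and S: "S \<subseteq> C"
    and g: "factorization {e \<in> F. f e \<in> S} S g" "\<forall>e. e \<notin> {e \<in> F. f e \<in> S} \<longrightarrow> g e = f e"
  shows "factorization F C g"
  unfolding factorization_def
proof (intro conjI ballI)
  have gS: "g e \<in> S \<longleftrightarrow> f e \<in> S" if "e \<in> F" for e
    using g that by (cases "f e \<in> S") (auto simp: factorization_def)
  show "F \<subseteq> E" using f by (simp add: factorization_def)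
  show "g ` F \<subseteq> C"
  proof
    fix c assume "c \<in> g ` F"
    then obtain e where e: "e \<in> F" "c = g e" by blast
    then show "c \<in> C" using gS[of e] S g(2) f by (cases "f e \<in> S") (auto simp: factorization_def)
  qed
  fix v c assume v: "v \<in> X \<union> Y" and c: "c \<in> C"
  show "\<exists>!e. e \<in> F \<and> inc e v \<and> g e = c"
  proof (cases "c \<in> S")
    case True
    then have "\<exists>!e. e \<in> {e \<in> F. f e \<in> S} \<and> inc e v \<and> g e = c" using factorization_ex1[OF g(1) v] by blast
    moreover have "e \<in> F \<and> inc e v \<and> g e = c \<longleftrightarrow> e \<in> {e \<in> F. f e \<in> S} \<and> inc e v \<and> g e = c" for e
      using gS[of e] True by blast
    ultimately show ?thesis by simp
  next
    case False
    have "\<exists>!e. e \<in> F \<and> inc e v \<and> f e = c" using factorization_ex1[OF f v c] .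
    moreover have "e \<in> F \<and> inc e v \<and> g e = c \<longleftrightarrow> e \<in> F \<and> inc e v \<and> f e = c" for e
      using gS[of e] False g(2) by (metis (no_types, lifting) mem_Collect_eq)
    ultimately show ?thesis by simp
  qed
qed

lemma step_patch:
  assumes f: "factorization F C f" and S: "S \<subseteq> C" "finite S" "card S \<le> n"
    and g: "factorization {e \<in> F. f e \<in> S} S g" "\<forall>e. e \<notin> {e \<in> F. f e \<in> S} \<longrightarrow> g e = f e"
  shows "step n F C f g"
proof -
  have "g e = f e" if "e \<in> F" "f e \<notin> S \<or> g e \<notin> S" for e
    using g that by (cases "f e \<in> S") (auto simp: factorization_def)
  then show ?thesis
    unfolding step_def using factorization_patch[OF f S(1) g] f S g(2) by blast
qed

text \<open>Steps inside the colours of \<open>S\<close> keep the set of edges coloured from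
  \<open>S\<close>, so the sub-multigraph cut out by the first colouring serves for the whole
  chain.\<close>

lemma steps_lift:
  assumes f: "factorization F C f" and S: "S \<subseteq> C"
    and "(step n {e \<in> F. f e \<in> S} S)\<^sup>*\<^sup>* f g"
  shows "(step n F C)\<^sup>*\<^sup>* f g"
  using assms(3)
proof (induction rule: rtranclp_induct)
  case (step g h)
  let ?F = "{e \<in> F. f e \<in> S}"
  have fS: "factorization ?F S f" by (rule factorization_restrict[OF f S])
  have g: "factorization ?F S g" "\<forall>e. e \<notin> ?F \<longrightarrow> g e = f e"
    using steps_factorization[OF step(1) fS] steps_outside[OF step(1)] by blast+
  have h: "factorization ?F S h" "\<forall>e. e \<notin> ?F \<longrightarrow> h e = g e"
    using step(2) unfolding step_def by blast+
  have h': "\<forall>e. e \<notin> ?F \<longrightarrow> h e = f e" using g(2) h(2) by simp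
  obtain T where T: "T \<subseteq> S" "finite T" "card T \<le> n" "\<forall>e\<in>?F. g e \<notin> T \<or> h e \<notin> T \<longrightarrow> h e = g e"
    using step(2) unfolding step_def by blast
  have "\<forall>e\<in>F. g e \<notin> T \<or> h e \<notin> T \<longrightarrow> h e = g e" using T(4) h(2) by blast
  moreover have "\<forall>e. e \<notin> F \<longrightarrow> h e = g e" using h(2) by blast
  ultimately have "step n F C g h"
    unfolding step_def
    using factorization_patch[OF f S g] factorization_patch[OF f S h(1) h'] T(1-3) S by blast
  then show ?case using step.IH by (rule rtranclp.rtrancl_into_rtrancl[rotated])
qed simp

lemma factorization_cong:
  assumes "factorization F C f" "\<And>e. e \<in> F \<Longrightarrow> g e = f e"
  shows "factorization F C g"
proof -
  have "(e \<in> F \<and> inc e v \<and> g e = c) = (e \<in> F \<and> inc e v \<and> f e = c)" for e v c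
    using assms(2) by auto
  moreover have "g ` F = f ` F" using assms(2) by (intro image_cong) auto
  ultimately show ?thesis using assms(1) unfolding factorization_def by simp
qed

lemma factorization_class_deg:
  assumes "factorization F C f" "v \<in> X \<union> Y" "c \<in> C"
  shows "deg {e \<in> F. f e = c} v = 1"
proof -
  have "(e \<in> {e \<in> F. f e = c} \<and> inc e v) = (e \<in> F \<and> inc e v \<and> f e = c)" for e by blast
  then show ?thesis unfolding deg_eq_1_iff using factorization_ex1[OF assms] by simp
qed

text \<open>Removing a perfect matching from the edges with colours in \<open>S\<close> leaves a
  regular multigraph, which Koenig's theorem colours anew with \<open>S - {c}\<close>. Nothing is
  kept of the old classes inside \<open>S\<close>, hence the cost \<open>card S\<close>.\<close>

lemma recolour_matching:
  assumes f: "factorization F C f" and S: "S \<subseteq> C" "finite S" "card S \<le> n" "c \<in> S"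
    and M: "M \<subseteq> {e \<in> F. f e \<in> S}" "\<And>v. v \<in> X \<union> Y \<Longrightarrow> deg M v = 1"
  shows "\<exists>g. step n F C f g \<and> {e \<in> F. g e = c} = M \<and> (\<forall>e\<in>F. f e \<in> S \<longrightarrow> g e \<in> S)"
proof -
  let ?F = "{e \<in> F. f e \<in> S}"
  have fS: "factorization ?F S f" by (rule factorization_restrict[OF f S(1)])
  have FE: "?F \<subseteq> E" using fS by (simp add: factorization_def)
  have "deg (?F - M) v = card (S - {c})" if "v \<in> X \<union> Y" for v
    using deg_Diff[OF M(1) FE] M(2)[OF that] factorization_deg[OF fS that] S by simp
  moreover have "finite (S - {c})" "?F - M \<subseteq> E" using S FE by auto
  ultimately obtain h where h: "factorization (?F - M) (S - {c}) h"
    using regular_factorization_exists by blast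
  have hS: "h e \<in> S - {c}" if "e \<in> ?F - M" for e
    using h that unfolding factorization_def by blast
  have "insert c (S - {c}) = S" using S(4) by blast
  then have 1: "factorization ?F S (\<lambda>e. if e \<in> M then c else h e)"
    using factorization_insert[OF h M(1) FE M(2), of c] by simp
  define g where "g e = (if e \<in> ?F then (if e \<in> M then c else h e) else f e)" for e
  have "factorization ?F S g"
    by (rule factorization_cong[OF 1]) (simp add: g_def)
  moreover have "\<forall>e. e \<notin> ?F \<longrightarrow> g e = f e" by (simp add: g_def)
  ultimately have "step n F C f g" by (rule step_patch[OF f S(1-3)])
  moreover have "{e \<in> F. g e = c} = M"
  proof -
    have "g e = c \<longleftrightarrow> e \<in> M" if e: "e \<in> F" for e
    proof (cases "e \<in> ?F")
      case True
      then show ?thesis using hS[of e] by (simp only: g_def) auto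
    next
      case False
      then have "f e \<noteq> c" "e \<notin> M" using e S(4) M(1) by auto
      then show ?thesis using False by (simp only: g_def) simp
    qed
    then show ?thesis using M(1) by blast
  qed
  moreover have "\<forall>e\<in>F. f e \<in> S \<longrightarrow> g e \<in> S"
    using hS S(4) by (auto simp: g_def)
  ultimately show ?thesis by blast
qed

text \<open>An exchange trades two edges with the same end in Y, so only degrees in X can go wrong.
  This is the one way in which they do: a surplus at \<open>x0\<close>, balanced by a gap at
  \<open>x1\<close>.\<close>

definition defect :: "'e set \<Rightarrow> 'v \<Rightarrow> 'v \<Rightarrow> bool" where
  "defect P x0 x1 \<longleftrightarrow> x0 \<in> X \<and> x1 \<in> X \<and> x0 \<noteq> x1 \<and> deg P x0 = 2 \<and> deg P x1 = 0 \<and>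
     (\<forall>v\<in>X \<union> Y - {x0, x1}. deg P v = 1)"

lemma exchange_perfect:
  assumes P: "P \<subseteq> E" "\<And>v. v \<in> X \<union> Y \<Longrightarrow> deg P v = 1"
    and e: "e \<in> E" "e \<notin> P" "e' \<in> P" "hy e' = hy e"
  shows "hx e = hx e' \<and> (\<forall>v\<in>X \<union> Y. deg (insert e (P - {e'})) v = 1)
    \<or> defect (insert e (P - {e'})) (hx e) (hx e')"
proof -
  let ?P = "insert e (P - {e'})"
  have e'E: "e' \<in> E" using e P by blast
  have inc: "inc e v \<longleftrightarrow> v = hx e \<or> v = hy e" "inc e' v \<longleftrightarrow> v = hx e' \<or> v = hy e" for v
    using e(4) by (auto simp: inc_def)
  have ne: "hx e \<noteq> hy e" "hx e' \<noteq> hy e" using hx_neq_hy[OF e(1)] hx_neq_hy[OF e'E] e(4) by auto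
  have X: "hx e \<in> X" "hx e' \<in> X" "hy e \<in> Y" using hx hy e(1) e'E by auto
  have D: "deg ?P v + of_bool (inc e' v) = 1 + of_bool (inc e v)" if "v \<in> X \<union> Y" for v
    using deg_exchange[OF P(1) e(2,3), of v] P(2)[OF that] by simp
  show ?thesis
  proof (cases "hx e = hx e'")
    case True
    then show ?thesis using D inc by auto
  next
    case False
    have "deg ?P (hx e) = 2" using D[of "hx e"] X False ne inc by simp
    moreover have "deg ?P (hx e') = 0" using D[of "hx e'"] X False ne inc by simp
    moreover have "deg ?P v = 1" if "v \<in> X \<union> Y - {hx e, hx e'}" for v
      using D[of v] that inc by simp
    ultimately show ?thesis using X False unfolding defect_def by blast
  qed
qed

text \<open>The incoming edge \<open>e\<close> is taken at the gap \<open>x1\<close> and closes it;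
  the outgoing edge moves the gap to \<open>hx e'\<close>. The surplus stays at \<open>x0\<close>
  until the gap arrives there and both disappear.\<close>

lemma exchange_defect:
  assumes P: "P \<subseteq> E" "defect P x0 x1"
    and e: "e \<in> E" "e \<notin> P" "e' \<in> P" "hy e' = hy e" "hx e = x1"
  shows "hx e' = x0 \<and> (\<forall>v\<in>X \<union> Y. deg (insert e (P - {e'})) v = 1)
    \<or> defect (insert e (P - {e'})) x0 (hx e')"
proof -
  let ?P = "insert e (P - {e'})"
  have x: "x0 \<in> X" "x1 \<in> X" "x0 \<noteq> x1" "deg P x0 = 2" "deg P x1 = 0"
    and dP: "\<And>v. v \<in> X \<union> Y \<Longrightarrow> v \<noteq> x0 \<Longrightarrow> v \<noteq> x1 \<Longrightarrow> deg P v = 1"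
    using P(2) unfolding defect_def by auto
  have e'E: "e' \<in> E" using e P by blast
  have inc: "inc e v \<longleftrightarrow> v = x1 \<or> v = hy e" "inc e' v \<longleftrightarrow> v = hx e' \<or> v = hy e" for v
    using e(4,5) by (auto simp: inc_def)
  have X: "hx e' \<in> X" "hy e \<in> Y" using hx hy e(1) e'E by auto
  have ne: "x0 \<noteq> hy e" "x1 \<noteq> hy e" "hx e' \<noteq> hy e" using x X disjXY by auto
  have "{e \<in> P. inc e x1} = {}" using x(5) fin_at[OF P(1)] by (simp add: deg_def)
  then have nx1: "hx e' \<noteq> x1" using e(3) inc_hx[of e'] by blast
  have D: "deg ?P v + of_bool (inc e' v) = deg P v + of_bool (inc e v)" for v
    using deg_exchange[OF P(1) e(2,3), of v] .
  have other: "deg ?P v = 1" if "v \<in> X \<union> Y" "v \<noteq> x0" "v \<noteq> hx e'" for v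
  proof (cases "v = x1")
    case True
    then show ?thesis using D[of v] x ne nx1 inc by simp
  next
    case False
    then show ?thesis using D[of v] dP[OF that(1,2)] that inc by simp
  qed
  show ?thesis
  proof (cases "hx e' = x0")
    case True
    then have "deg ?P x0 = 1" using D[of x0] x ne inc by simp
    then show ?thesis using True other by auto
  next
    case False
    have "deg ?P x0 = 2" using D[of x0] x ne False inc by simp
    moreover have "deg ?P (hx e') = 0"
      using D[of "hx e'"] dP[of "hx e'"] X False nx1 ne inc by simp
    ultimately show ?thesis using X False x other unfolding defect_def by blast
  qed
qed

text \<open>In the cubic multigraph of the colours \<open>S\<close> the complement of
  \<open>P\<close> has degree 2, except 1 at \<open>x0\<close> and 3 at \<open>x1\<close>. As 3 is
  less than twice 2, the matching lemma with one exceptional vertex applies with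
  \<open>d = 2\<close>; the matching becomes class \<open>b\<close> and frees \<open>P\<close> from
  that colour.\<close>

lemma recolour_defect:
  assumes f: "factorization F C f" and S: "S \<subseteq> C" "card S = 3" "b \<in> S"
    and P: "P \<subseteq> {e \<in> F. f e \<in> S}" "defect P x0 x1"
  shows "\<exists>g. step 3 F C f g \<and> P \<subseteq> {e \<in> F. g e \<in> S - {b}}"
proof -
  let ?F = "{e \<in> F. f e \<in> S}"
  have finS: "finite S" using S(2) card.infinite by fastforce
  have fS: "factorization ?F S f" by (rule factorization_restrict[OF f S(1)])
  have FE: "?F \<subseteq> E" using fS by (simp add: factorization_def)
  have x: "x0 \<in> X" "x1 \<in> X" "x0 \<noteq> x1" "deg P x0 = 2" "deg P x1 = 0"
    and dP: "\<And>v. v \<in> X \<union> Y \<Longrightarrow> v \<noteq> x0 \<Longrightarrow> v \<noteq> x1 \<Longrightarrow> deg P v = 1"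
    using P(2) unfolding defect_def by auto
  have D: "deg (?F - P) v = 3 - deg P v" if "v \<in> X \<union> Y" for v
    using deg_Diff[OF P(1) FE] factorization_deg[OF fS that] S(2) by simp
  have "\<exists>M\<subseteq>?F - P. \<forall>v\<in>X \<union> Y. deg M v = 1"
  proof (rule perfect_matching_exists[where d = 2 and x' = x1])
    show "?F - P \<subseteq> E" using FE by blast
    show "card X = card Y"
      using regular_card_eq[OF FE factorization_deg[OF fS]] S(2) by simp
    show "2 \<le> deg (?F - P) y" if "y \<in> Y" for y
    proof -
      have "y \<noteq> x0" "y \<noteq> x1" using that x disjXY by auto
      then show ?thesis using D[of y] dP[of y] that by simp
    qed
    show "deg (?F - P) v \<le> 2" if "v \<in> X" "v \<noteq> x1" for v
      using D[of v] dP[of v] that x by (cases "v = x0") auto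
    show "deg (?F - P) x1 < 2 * 2" using D[of x1] x by simp
  qed simp
  then obtain M where M: "M \<subseteq> ?F - P" "\<And>v. v \<in> X \<union> Y \<Longrightarrow> deg M v = 1" by blast
  have "M \<subseteq> ?F" using M(1) by blast
  then obtain g where g: "step 3 F C f g" "{e \<in> F. g e = b} = M" "\<forall>e\<in>F. f e \<in> S \<longrightarrow> g e \<in> S"
    using recolour_matching[OF f S(1) finS _ S(3) _ M(2)] S(2) by auto
  have "P \<subseteq> {e \<in> F. g e \<in> S - {b}}" using g(2,3) M(1) P(1) by blast
  then show ?thesis using g(1) by blast
qed

lemma perfect_subset_eq:
  assumes "M \<subseteq> N" "N \<subseteq> E" "\<And>v. v \<in> X \<union> Y \<Longrightarrow> deg M v = 1" "\<And>v. v \<in> X \<union> Y \<Longrightarrow> deg N v = 1"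
  shows "M = N"
proof
  show "N \<subseteq> M"
  proof
    fix e assume e: "e \<in> N"
    then have v: "hx e \<in> X \<union> Y" using assms(2) hx by blast
    have "\<exists>!e'. e' \<in> M \<and> inc e' (hx e)" using assms(3)[OF v] unfolding deg_eq_1_iff .
    then obtain e' where e': "e' \<in> M" "inc e' (hx e)" by blast
    have "\<exists>!e'. e' \<in> N \<and> inc e' (hx e)" using assms(4)[OF v] unfolding deg_eq_1_iff .
    then have "e' = e" using e' e assms(1) inc_hx[of e] by blast
    then show "e \<in> M" using e' by blast
  qed
qed fact

text \<open>A colour class is turned into the prescribed perfect matching \<open>N\<close> by exchanging, one at a
  time, an edge of \<open>N\<close> against an edge outside \<open>N\<close>. The intermediate edge set \<open>P\<close> need not be a
  matching, but it always stays inside the union of two colour classes; keeping it there costs one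
  recolouring of three classes per exchange.\<close>

lemma steps_to_class:
  assumes N: "N \<subseteq> F" "\<And>v. v \<in> X \<union> Y \<Longrightarrow> deg N v = 1" and c: "c \<in> C"
    and "factorization F C f"
    and "P = {e \<in> F. f e = c} \<or>
      (\<exists>a x0 x1. a \<in> C \<and> a \<noteq> c \<and> P \<subseteq> {e \<in> F. f e \<in> {c, a}} \<and> defect P x0 x1)"
  shows "\<exists>g. (step 3 F C)\<^sup>*\<^sup>* f g \<and> {e \<in> F. g e = c} = N"
  using assms(4,5)
proof (induction "card (N - P)" arbitrary: f P rule: less_induct)
  case less
  note f = less.prems(1)
  have FE: "F \<subseteq> E" using f by (simp add: factorization_def)
  have finN: "finite N" by (rule finite_subset[OF subset_trans[OF N(1) FE] finE])
  have decrease: "card (N - insert e (P - {e'})) < card (N - P)"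
    if "e \<in> N" "e \<notin> P" "e' \<in> P" "hy e' = hy e" for e e'
  proof (rule psubset_card_mono)
    show "finite (N - P)" using finN by blast
    \<comment> \<open>\<open>N\<close> has a single edge at \<open>hy e\<close>, namely
      \<open>e\<close>; so the discarded edge is not in \<open>N\<close> and no progress is
      undone.\<close>
    have "hy e \<in> X \<union> Y" using hy that N FE by blast
    then have "\<exists>!e. e \<in> N \<and> inc e (hy e')" using N(2) that(4) unfolding deg_eq_1_iff[symmetric] by simp
    then have "e' \<notin> N" using that inc_hy[of e] inc_hy[of e'] by metis
    then show "N - insert e (P - {e'}) \<subset> N - P" using that by blast
  qed
  have continue: "\<exists>g. (step 3 F C)\<^sup>*\<^sup>* f g \<and> {e \<in> F. g e = c} = N"
    if g: "step 3 F C f g" "card (N - P') < card (N - P)" "P' = {e \<in> F. g e = c} \<or>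
      (\<exists>a x0 x1. a \<in> C \<and> a \<noteq> c \<and> P' \<subseteq> {e \<in> F. g e \<in> {c, a}} \<and> defect P' x0 x1)" for g P'
  proof -
    have "factorization F C g" using g(1) by (simp add: step_def)
    then obtain h where h: "(step 3 F C)\<^sup>*\<^sup>* g h" "{e \<in> F. h e = c} = N"
      using less.hyps[OF g(2) _ g(3)] by blast
    show ?thesis using converse_rtranclp_into_rtranclp[OF g(1) h(1)] h(2) by blast
  qed
  \<comment> \<open>Sometimes only \<open>P\<close> advances and the colouring rests; the empty set
    of changed colours makes this a step, so that \<open>continue\<close> treats both cases.\<close>
  have refl: "step 3 F C f f" using f unfolding step_def by (intro conjI exI[of _ "{}"]) auto
  from less.prems(2) show ?case
  proof (elim disjE exE conjE)
    assume P: "P = {e \<in> F. f e = c}"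
    have dP: "deg P v = 1" if "v \<in> X \<union> Y" for v
      unfolding P by (rule factorization_class_deg[OF f that c])
    have PE: "P \<subseteq> E" using P FE by blast
    show ?thesis
    proof (cases "N \<subseteq> P")
      case True
      then have "N = P" using perfect_subset_eq[OF _ PE N(2) dP] by blast
      then show ?thesis using P by blast
    next
      case False
      then obtain e where e: "e \<in> N" "e \<notin> P" by blast
      have eE: "e \<in> F" "e \<in> E" using e N FE by auto
      then have y: "hy e \<in> Y" using hy by blast
      have "\<exists>!e'. e' \<in> P \<and> inc e' (hy e)" using dP y unfolding deg_eq_1_iff by blast
      then obtain e' where "e' \<in> P" "inc e' (hy e)" by blast
      then have e': "e' \<in> P" "hy e' = hy e" using inc_Y[of e' "hy e"] PE y by auto
      define P' where "P' = insert e (P - {e'})"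
      define a where "a = f e"
      have a: "a \<in> C" "a \<noteq> c" using f eE e P by (auto simp: factorization_def a_def)
      have P'S: "P' \<subseteq> {e \<in> F. f e \<in> {c, a}}" using P eE by (auto simp: P'_def a_def)
      have dec: "card (N - P') < card (N - P)"
        unfolding P'_def by (rule decrease[OF e e'])
      have "hx e = hx e' \<and> (\<forall>v\<in>X \<union> Y. deg P' v = 1) \<or> defect P' (hx e) (hx e')"
        unfolding P'_def by (rule exchange_perfect[OF PE _ eE(2) e(2) e']) (rule dP)
      then show ?thesis
      proof (elim disjE conjE)
        assume "\<forall>v\<in>X \<union> Y. deg P' v = 1"
        moreover have "card {c, a} \<le> 3" by (simp add: card_insert_if)
        ultimately obtain g where g: "step 3 F C f g" "{e \<in> F. g e = c} = P'"
          using recolour_matching[OF f, of "{c, a}" 3 c P'] P'S a c by auto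
        then show ?thesis using continue[OF g(1) dec] by blast
      next
        assume "defect P' (hx e) (hx e')"
        then show ?thesis using continue[OF refl dec] P'S a by blast
      qed
    qed
  next
    fix a x0 x1 assume a: "a \<in> C" "a \<noteq> c" and PS: "P \<subseteq> {e \<in> F. f e \<in> {c, a}}" and D: "defect P x0 x1"
    have PE: "P \<subseteq> E" using PS FE by blast
    have x1: "x1 \<in> X" "deg P x1 = 0" "x0 \<in> X" using D by (auto simp: defect_def)
    \<comment> \<open>\<open>N\<close> covers the gap \<open>x1\<close> while \<open>P\<close>
      misses it, so an exchange is always available.\<close>
    have "\<exists>!e. e \<in> N \<and> inc e x1" using N(2)[of x1] x1(1) unfolding deg_eq_1_iff by blast
    then obtain e where e0: "e \<in> N" "inc e x1" by blast
    have eE: "e \<in> F" "e \<in> E" using e0 N FE by auto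
    then have y: "hy e \<in> Y" using hy by blast
    have ex: "hx e = x1" using inc_X[OF eE(2) x1(1)] e0 by blast
    have "{e \<in> P. inc e x1} = {}" using x1(2) fin_at[OF PE] by (simp add: deg_def)
    then have e: "e \<in> N" "e \<notin> P" using e0 by auto
    have "hy e \<noteq> x0" "hy e \<noteq> x1" using y x1 disjXY by auto
    then have "deg P (hy e) = 1" using D y unfolding defect_def by blast
    then have "\<exists>!e'. e' \<in> P \<and> inc e' (hy e)" unfolding deg_eq_1_iff .
    then obtain e' where "e' \<in> P" "inc e' (hy e)" by blast
    then have e': "e' \<in> P" "hy e' = hy e" using inc_Y[of e' "hy e"] PE y by auto
    define P' where "P' = insert e (P - {e'})"
    define b where "b = f e"
    have b: "b \<in> C" using f eE by (auto simp: factorization_def b_def)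
    have P'S: "P' \<subseteq> {e \<in> F. f e \<in> {c, a, b}}" using PS eE by (auto simp: P'_def b_def)
    have dec: "card (N - P') < card (N - P)"
      unfolding P'_def by (rule decrease[OF e e'])
    from exchange_defect[OF PE D eE(2) e(2) e' ex, folded P'_def]
    show ?thesis
    proof (elim disjE conjE)
      assume "\<forall>v\<in>X \<union> Y. deg P' v = 1"
      moreover have "card {c, a, b} \<le> 3" by (simp add: card_insert_if)
      ultimately obtain g where g: "step 3 F C f g" "{e \<in> F. g e = c} = P'"
        using recolour_matching[OF f, of "{c, a, b}" 3 c P'] P'S a b c by auto
      then show ?thesis using continue[OF g(1) dec] by blast
    next
      assume D': "defect P' x0 (hx e')"
      show ?thesis
      proof (cases "b \<in> {c, a}")
        case True
        then have "P' \<subseteq> {e \<in> F. f e \<in> {c, a}}" using P'S by blast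
        then show ?thesis using continue[OF refl dec] D' a by blast
      next
        \<comment> \<open>\<open>P'\<close> now spreads over three colours; recolouring them frees
          \<open>P'\<close> from \<open>b\<close> and restores the invariant of two colours.\<close>
        case False
        then have "card {c, a, b} = 3" "{c, a, b} - {b} = {c, a}" using a by auto
        moreover have "{c, a, b} \<subseteq> C" using a b c by blast
        ultimately obtain g where g: "step 3 F C f g" "P' \<subseteq> {e \<in> F. g e \<in> {c, a}}"
          using recolour_defect[OF f _ _ _ P'S D', of b] by auto
        then show ?thesis using continue[OF g(1) dec] D' a by blast
      qed
    qed
  qed
qed

text \<open>Colours are settled one after another: once the class of \<open>c\<close> agrees with
  \<open>g\<close> it is left alone, and the rest is the same problem for the remaining colours on
  the remaining edges.\<close>

theorem three_equivalent:
  assumes "finite C" "factorization F C f" "factorization F C g" "\<forall>e. e \<notin> F \<longrightarrow> g e = f e"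
  shows "(step 3 F C)\<^sup>*\<^sup>* f g"
  using assms
proof (induction C arbitrary: F f rule: finite_induct)
  case empty
  then have "F = {}" by (auto simp: factorization_def)
  then have "f = g" using empty.prems(3) by (metis empty_iff ext)
  then show ?case by simp
next
  case (insert c C)
  note f = insert.prems(1) and g = insert.prems(2)
  define N where "N = {e \<in> F. g e = c}"
  have c: "c \<in> insert c C" by simp
  have "deg N v = 1" if "v \<in> X \<union> Y" for v
    unfolding N_def by (rule factorization_class_deg[OF g that c])
  then obtain h where h: "(step 3 F (insert c C))\<^sup>*\<^sup>* f h" "{e \<in> F. h e = c} = N"
    using steps_to_class[of N F c "insert c C" f "{e \<in> F. f e = c}"] f N_def by blast
  have hf: "factorization F (insert c C) h" using steps_factorization[OF h(1) f] .
  have off: "g e = h e" if "e \<notin> F" for e using steps_outside[OF h(1) that] insert.prems(3) that by simp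
  let ?F = "{e \<in> F. h e \<in> C}"
  have hF: "h e \<in> insert c C" "g e \<in> insert c C" if "e \<in> F" for e
    using hf g that by (auto simp: factorization_def)
  have hc: "h e = c \<longleftrightarrow> g e = c" if "e \<in> F" for e using h(2) that unfolding N_def by blast
  have memC: "h e \<in> C \<longleftrightarrow> g e \<in> C" if "e \<in> F" for e
    using hF[OF that] hc[OF that] insert.hyps(2) by auto
  have eqF: "?F = {e \<in> F. g e \<in> C}"
    by (rule Collect_cong) (use memC in blast)
  have sub: "C \<subseteq> insert c C" by blast
  have "(step 3 ?F C)\<^sup>*\<^sup>* h g"
  proof (rule insert.IH)
    show "factorization ?F C h" by (rule factorization_restrict[OF hf sub])
    show "factorization ?F C g" unfolding eqF by (rule factorization_restrict[OF g sub])
    have "g e = h e" if "e \<notin> ?F" for e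
    proof (cases "e \<in> F")
      case True
      then have "h e = c" using that hF(1)[OF True] by blast
      then show ?thesis using hc[OF True] by simp
    qed (rule off)
    then show "\<forall>e. e \<notin> ?F \<longrightarrow> g e = h e" by blast
  qed
  then have "(step 3 F (insert c C))\<^sup>*\<^sup>* h g" by (rule steps_lift[OF hf sub])
  then show ?case using h(1) by (meson rtranclp_trans)
qed

end

section \<open>Winding numbers of 1-cycles in a plane bipartite multigraph\<close>

text \<open>Arcs run from the X end to the Y end. This direction does not depend on a colouring, so
  the 1-cycles of two colourings can be subtracted.\<close>

locale plane_bigraph = bigraph X Y E hx hy
  for X Y :: "'v set" and E :: "'e set" and hx hy :: "'e \<Rightarrow> 'v" +
  fixes p :: "'v \<Rightarrow> complex" and d :: "'e \<Rightarrow> real \<Rightarrow> complex"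
  assumes inj_p: "inj_on p (X \<union> Y)"
    and arc_d: "e \<in> E \<Longrightarrow> arc (d e)"
    and start_d: "e \<in> E \<Longrightarrow> pathstart (d e) = p (hx e)"
    and finish_d: "e \<in> E \<Longrightarrow> pathfinish (d e) = p (hy e)"
    and vertex_on_d: "e \<in> E \<Longrightarrow> v \<in> X \<union> Y \<Longrightarrow> p v \<in> path_image (d e) \<Longrightarrow> inc e v"
    and crossing_d: "e \<in> E \<Longrightarrow> e' \<in> E \<Longrightarrow> e \<noteq> e' \<Longrightarrow> z \<in> path_image (d e) \<Longrightarrow>
          z \<in> path_image (d e') \<Longrightarrow> \<exists>v. z = p v \<and> inc e v \<and> inc e' v"
begin

lemma path_d: "e \<in> E \<Longrightarrow> path (d e)"
  by (simp add: arc_d arc_imp_path)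

text \<open>The winding number of one open arc is no integer in general; only for a 1-cycle, and off
  the edges with nonzero coefficient, does the sum behave well. Edges of coefficient 0 contribute
  nothing even at their own points.\<close>

definition winding :: "('e \<Rightarrow> int) \<Rightarrow> complex \<Rightarrow> complex" where
  "winding k z = (\<Sum>e\<in>E. of_int (k e) * winding_number (d e) z)"

definition supp :: "('e \<Rightarrow> int) \<Rightarrow> complex set" where
  "supp k = (\<Union>e\<in>{e \<in> E. k e \<noteq> 0}. path_image (d e))"

lemma winding_diff: "winding (\<lambda>e. k e - l e) z = winding k z - winding l z"
  by (simp add: winding_def sum_subtractf left_diff_distrib)

lemma winding_supp: "winding k z = (\<Sum>e | e \<in> E \<and> k e \<noteq> 0. of_int (k e) * winding_number (d e) z)"
  unfolding winding_def using finE by (intro sum.mono_neutral_right) auto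

lemma closed_supp: "closed (supp k)"
  unfolding supp_def using finE path_d
  by (intro closed_UN) (auto intro: closed_path_image)

lemma continuous_W: "continuous_on (- supp k) (winding k)"
proof -
  have "continuous_on (- supp k) (\<lambda>z. of_int (k e) * winding_number (d e) z)"
    if "e \<in> {e. e \<in> E \<and> k e \<noteq> 0}" for e
  proof -
    have "continuous (at z) (winding_number (d e))" if "z \<in> - supp k" for z
      using that \<open>e \<in> _\<close> by (intro continuous_at_winding_number path_d) (auto simp: supp_def)
    then have "continuous_on (- supp k) (winding_number (d e))"
      by (simp add: continuous_at_imp_continuous_on)
    then show ?thesis by (rule continuous_on_mult_left)
  qed
  then show ?thesis
    unfolding winding_supp by (rule continuous_on_sum)
qed

text \<open>Modulo integers the value depends only on the end points, through one logarithm per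
  vertex; summed over a 1-cycle these terms cancel.\<close>

lemma winding_number_edge:
  assumes "e \<in> E" "z \<notin> path_image (d e)"
  shows "\<exists>n::int. winding_number (d e) z =
    (Ln (p (hy e) - z) - Ln (p (hx e) - z)) / (2 * pi * \<i>) + of_int n"
proof -
  let ?A = "p (hx e) - z" and ?B = "p (hy e) - z" and ?w = "winding_number (d e) z"
  have ne: "?A \<noteq> 0" "?B \<noteq> 0"
    using assms pathstart_in_path_image[of "d e"] pathfinish_in_path_image[of "d e"]
    by (auto simp: start_d finish_d)
  have "?B = exp (2 * pi * \<i> * ?w) * ?A"
    using winding_number_exp_2pi[OF path_d assms(2)] assms by (simp add: start_d finish_d)
  then have "exp (2 * pi * \<i> * ?w + Ln ?A) = exp (Ln ?B)"
    using ne by (simp add: exp_add)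
  then obtain n :: int where "2 * pi * \<i> * ?w + Ln ?A = Ln ?B + of_int (2 * n) * pi * \<i>"
    by (auto simp: exp_eq)
  then have "?w = (Ln ?B - Ln ?A) / (2 * pi * \<i>) + of_int n"
    by (simp add: field_simps)
  then show ?thesis by blast
qed

lemma winding_int:
  assumes k: "cycle_chain k" and z: "z \<notin> supp k"
  shows "winding k z \<in> \<int>"
proof -
  define L where "L v = Ln (p v - z)" for v
  have "\<forall>e. \<exists>n::int. e \<in> E \<and> k e \<noteq> 0 \<longrightarrow>
      winding_number (d e) z = (L (hy e) - L (hx e)) / (2 * pi * \<i>) + of_int n"
    using z winding_number_edge unfolding L_def supp_def by blast
  then obtain n :: "'e \<Rightarrow> int" where n: "\<And>e. e \<in> E \<Longrightarrow> k e \<noteq> 0 \<Longrightarrow>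
      winding_number (d e) z = (L (hy e) - L (hx e)) / (2 * pi * \<i>) + of_int (n e)"
    by metis
  have "winding k z = (\<Sum>e\<in>E. of_int (k e) * ((L (hy e) - L (hx e)) / (2 * pi * \<i>) + of_int (n e)))"
    unfolding winding_def
  proof (rule sum.cong[OF refl])
    fix e assume "e \<in> E"
    then show "of_int (k e) * winding_number (d e) z
        = of_int (k e) * ((L (hy e) - L (hx e)) / (2 * pi * \<i>) + of_int (n e))"
      using n[of e] by (cases "k e = 0") auto
  qed
  also have "\<dots> = ((\<Sum>e\<in>E. of_int (k e) * L (hy e)) - (\<Sum>e\<in>E. of_int (k e) * L (hx e))) / (2 * pi * \<i>)
      + of_int (\<Sum>e\<in>E. k e * n e)"
    by (simp add: sum_subtractf[symmetric] sum_divide_distrib sum.distrib[symmetric] algebra_simps diff_divide_distrib)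
  \<comment> \<open>Each \<open>L v\<close> is multiplied by the sum of \<open>k\<close> at
    \<open>v\<close>, which is 0. This also disposes of the case \<open>z = p v\<close>, where
    \<open>L v\<close> is the meaningless \<open>Ln 0\<close>.\<close>
  also have "(\<Sum>e\<in>E. of_int (k e) * L (hy e)) = (\<Sum>y\<in>Y. \<Sum>e | e \<in> E \<and> hy e = y. of_int (k e) * L (hy e))"
    using finE finY hy by (intro sum.group[symmetric]) auto
  also have "\<dots> = (\<Sum>y\<in>Y. of_int (\<Sum>e | e \<in> E \<and> inc e y. k e) * L y)"
    unfolding of_int_sum sum_distrib_right
    by (intro sum.cong refl) (auto simp: inc_Y)
  also have "\<dots> = 0"
    using k by (intro sum.neutral) (auto simp: cycle_chain_def simp del: of_int_sum)
  also have "(\<Sum>e\<in>E. of_int (k e) * L (hx e)) = (\<Sum>x\<in>X. \<Sum>e | e \<in> E \<and> hx e = x. of_int (k e) * L (hx e))"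
    using finE finX hx by (intro sum.group[symmetric]) auto
  also have "\<dots> = (\<Sum>x\<in>X. of_int (\<Sum>e | e \<in> E \<and> inc e x. k e) * L x)"
    unfolding of_int_sum sum_distrib_right
    by (intro sum.cong refl) (auto simp: inc_X)
  also have "\<dots> = 0"
    using k by (intro sum.neutral) (auto simp: cycle_chain_def simp del: of_int_sum)
  finally show ?thesis by (simp del: of_int_sum)
qed

text \<open>Continuous and integer valued on a connected set. \<open>S\<close> has to avoid only the
  edges with nonzero coefficient, so it may run along other edges and through their ends.\<close>

lemma winding_constant:
  assumes k: "cycle_chain k" and S: "connected S" "S \<inter> supp k = {}" and "z \<in> S" "w \<in> S"
  shows "winding k z = winding k w"
proof -
  have "winding k constant_on S"
  proof (rule continuous_discrete_range_constant[OF S(1)])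
    show "continuous_on S (winding k)"
      using S(2) by (intro continuous_on_subset[OF continuous_W]) auto
    fix x assume "x \<in> S"
    have "1 \<le> norm (winding k y - winding k x)" if "y \<in> S" "winding k y \<noteq> winding k x" for y
    proof -
      have "winding k y - winding k x \<in> \<int>"
        using winding_int[OF k] S(2) that \<open>x \<in> S\<close> by (intro Ints_diff) auto
      then obtain n where n: "winding k y - winding k x = of_int n" by (auto elim: Ints_cases)
      then have "n \<noteq> 0" using that by auto
      then show ?thesis using n by simp
    qed
    then show "\<exists>e>0. \<forall>y. y \<in> S \<and> winding k y \<noteq> winding k x \<longrightarrow> e \<le> norm (winding k y - winding k x)"
      by (intro exI[of _ 1]) auto
  qed
  then show ?thesis using assms by (auto simp: constant_on_def)
qed

section \<open>Evaluation at midpoints of edges\<close>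

definition mid :: "'e \<Rightarrow> complex" where
  "mid e = d e (1/2)"

lemma mid_on: "mid e \<in> path_image (d e)"
  by (simp add: mid_def path_image_def)

lemma mid_not_vertex:
  assumes "e \<in> E" "v \<in> X \<union> Y"
  shows "mid e \<noteq> p v"
proof
  assume eq: "mid e = p v"
  then have "inc e v" using assms mid_on vertex_on_d by metis
  then have "p v = d e 0 \<or> p v = d e 1"
    using assms start_d finish_d by (auto simp: inc_def pathstart_def pathfinish_def)
  then show False
    using eq arc_d[OF assms(1)] inj_onD[of "d e" "{0..1}" "1/2" 0] inj_onD[of "d e" "{0..1}" "1/2" 1]
    by (auto simp: arc_def mid_def)
qed

lemma mid_not_on:
  assumes "e \<in> E" "e' \<in> E" "e \<noteq> e'"
  shows "mid e \<notin> path_image (d e')"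
  using assms crossing_d[of e e' "mid e"] mid_on[of e] mid_not_vertex inc_vertex by metis

lemma mid_supp: "e \<in> E \<Longrightarrow> k e = 0 \<Longrightarrow> mid e \<notin> supp k"
  using mid_not_on by (auto simp: supp_def)

text \<open>The half of the edge from \<open>p v\<close> to the midpoint misses
  \<open>supp k\<close>: other edges meet \<open>e\<close> only in its ends, no edge at
  \<open>v\<close> has a nonzero coefficient, and the other end, where nothing is known, lies on the
  other half.\<close>

lemma winding_half_edge:
  assumes k: "cycle_chain k" and e: "e \<in> E" "inc e v" and "\<And>e'. e' \<in> E \<Longrightarrow> inc e' v \<Longrightarrow> k e' = 0"
  shows "winding k (mid e) = winding k (p v)"
proof -
  define I where "I = (if hx e = v then {0..1/2::real} else {1/2..1})"
  define S where "S = d e ` I"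
  have v: "v \<in> X \<union> Y" using e inc_vertex by auto
  have I: "I \<subseteq> {0..1}" by (auto simp: I_def)
  have inj: "inj_on (d e) {0..1}" using arc_d[OF e(1)] by (simp add: arc_def)
  have "continuous_on {0..1} (d e)" using path_d[OF e(1)] by (simp add: path_def)
  then have "continuous_on I (d e)" using I continuous_on_subset by blast
  then have "connected S"
    unfolding S_def by (rule connected_continuous_image) (auto simp: I_def)
  moreover have pv: "p v = d e (if hx e = v then 0 else 1)"
    using e start_d finish_d by (auto simp: inc_def pathstart_def pathfinish_def)
  then have "p v \<in> S" by (auto simp: S_def I_def)
  moreover have "mid e \<in> S" by (auto simp: S_def I_def mid_def)
  moreover have "S \<inter> supp k = {}"
  proof (rule ccontr)
    assume "S \<inter> supp k \<noteq> {}"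
    then obtain z e' where z: "z \<in> S" "z \<in> path_image (d e')" and e': "e' \<in> E" "k e' \<noteq> 0"
      by (auto simp: supp_def)
    have "e \<noteq> e'" "\<not> inc e' v" using e' assms by auto
    moreover have "z \<in> path_image (d e)" using z I by (auto simp: S_def path_image_def)
    ultimately obtain u where u: "z = p u" "inc e u" "inc e' u"
      using crossing_d[of e e' z] e e' z by auto
    then have "u \<noteq> v" using \<open>\<not> inc e' v\<close> by auto
    then have "p u = d e (if hx e = v then 1 else 0)"
      using e u start_d finish_d by (auto simp: inc_def pathstart_def pathfinish_def)
    moreover obtain s where "s \<in> I" "p u = d e s" using z u by (auto simp: S_def)
    ultimately show False
      using inj I inj_onD[OF inj, of s "if hx e = v then 1 else 0"] by (auto simp: I_def split: if_splits)
  qed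
  ultimately show ?thesis using winding_constant[OF k] by blast
qed

lemma winding_eventually_const:
  assumes "cycle_chain k" "z \<notin> supp k"
  shows "\<forall>\<^sub>F w in nhds z. winding k w = winding k z"
proof -
  obtain r where r: "r > 0" "ball z r \<subseteq> - supp k"
    using assms(2) closed_supp open_contains_ball[of "- supp k"] by (metis ComplI open_Compl)
  have "\<forall>\<^sub>F w in nhds z. w \<in> ball z r"
    using r by (intro eventually_nhds_in_open) auto
  then show ?thesis
  proof (rule eventually_mono)
    fix w assume "w \<in> ball z r"
    then show "winding k w = winding k z"
      using r by (intro winding_constant[OF assms(1) connected_ball[of z r]]) auto
  qed
qed

section \<open>Kempe cycles as simple closed curves\<close>

lemma closed_walk_simple_path:
  assumes N: "N \<ge> 2" and g: "\<And>n. n < N \<Longrightarrow> g n \<in> E"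
    and ends: "\<And>n. n < N \<Longrightarrow> hx (g n) = z n \<and> hy (g n) = z (Suc n) \<or> hy (g n) = z n \<and> hx (g n) = z (Suc n)"
    and z: "inj_on z {..<N}" "z N = z 0" and g_inj: "inj_on g {..<N}"
  obtains \<gamma> where "simple_path \<gamma>" "pathfinish \<gamma> = pathstart \<gamma>"
    "path_image \<gamma> = (\<Union>n<N. path_image (d (g n)))"
    "\<And>w. w \<notin> path_image \<gamma> \<Longrightarrow> winding_number \<gamma> w =
       (\<Sum>n<N. (if hx (g n) = z n then 1 else -1) * winding_number (d (g n)) w)"
proof -
  define D where "D n = (if hx (g n) = z n then d (g n) else reversepath (d (g n)))" for n
  define wn where "wn w n = (if hx (g n) = z n then 1 else -1) * winding_number (d (g n)) w" for w n
  have D: "arc (D n)" "pathstart (D n) = p (z n)" "pathfinish (D n) = p (z (Suc n))"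
    "path_image (D n) = path_image (d (g n))" if "n < N" for n
    using ends[OF that] hx_neq_hy[OF g[OF that]] arc_d[OF g[OF that]]
      start_d[OF g[OF that]] finish_d[OF g[OF that]]
    by (auto simp: D_def arc_reversepath)
  have wD: "winding_number (D n) w = wn w n" if "n < N" "w \<notin> path_image (d (g n))" for n w
    using that path_d[OF g[OF that(1)]] by (auto simp: D_def wn_def winding_number_reversepath)
  have meet: "\<exists>v. w = p v \<and> v \<in> {z m, z (Suc m)} \<and> v \<in> {z n, z (Suc n)}"
    if mn: "m < n" "n < N" "w \<in> path_image (d (g m))" "w \<in> path_image (d (g n))" for m n w
  proof -
    \<comment> \<open>For \<open>N = 2\<close>, injectivity of \<open>z\<close> does not exclude one
      edge traversed back and forth; injectivity of \<open>g\<close> does.\<close>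
    have "g m \<noteq> g n" using mn inj_onD[OF g_inj, of m n] by auto
    then obtain v where "w = p v" "inc (g m) v" "inc (g n) v"
      using crossing_d[of "g m" "g n" w] mn g[of m] g[of n] by auto
    then show ?thesis using ends[of m] ends[of n] mn by (auto simp: inc_def)
  qed
  \<comment> \<open>The edges up to index \<open>N - 2\<close> form an arc; the last one meets both
    ends of this arc and is joined separately to close the loop.\<close>
  have "\<exists>\<gamma>. arc \<gamma> \<and> pathstart \<gamma> = p (z 0) \<and> pathfinish \<gamma> = p (z (Suc n)) \<and>
      path_image \<gamma> = (\<Union>m\<le>n. path_image (d (g m))) \<and>
      (\<forall>w. w \<notin> path_image \<gamma> \<longrightarrow> winding_number \<gamma> w = (\<Sum>m\<le>n. wn w m))" if "Suc n < N" for n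
    using that
  proof (induction n)
    case 0
    then show ?case
      using D[of 0] wD[of 0] by (intro exI[of _ "D 0"]) auto
  next
    case (Suc n)
    then obtain \<gamma> where \<gamma>: "arc \<gamma>" "pathstart \<gamma> = p (z 0)" "pathfinish \<gamma> = p (z (Suc n))"
      "path_image \<gamma> = (\<Union>m\<le>n. path_image (d (g m)))"
      "\<And>w. w \<notin> path_image \<gamma> \<Longrightarrow> winding_number \<gamma> w = (\<Sum>m\<le>n. wn w m)"
      by auto
    note D' = D[of "Suc n"] Suc.prems
    have join: "pathfinish \<gamma> = pathstart (D (Suc n))" using D' \<gamma> by simp
    have "path_image \<gamma> \<inter> path_image (D (Suc n)) \<subseteq> {pathstart (D (Suc n))}"
    proof
      fix w assume w: "w \<in> path_image \<gamma> \<inter> path_image (D (Suc n))"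
      then obtain m where m: "m \<le> n" "w \<in> path_image (d (g m))" using \<gamma> by auto
      obtain v where v: "w = p v" "v \<in> {z m, z (Suc m)}" "v \<in> {z (Suc n), z (Suc (Suc n))}"
        using meet[of m "Suc n" w] m w D' by auto
      have "v \<noteq> z (Suc (Suc n))"
      proof
        assume "v = z (Suc (Suc n))"
        then consider "z m = z (Suc (Suc n))" | "z (Suc m) = z (Suc (Suc n))" using v by auto
        then show False
          using inj_onD[OF z(1), of m "Suc (Suc n)"] inj_onD[OF z(1), of "Suc m" "Suc (Suc n)"]
            Suc.prems m by cases auto
      qed
      then show "w \<in> {pathstart (D (Suc n))}" using v D' by auto
    qed
    then have "arc (\<gamma> +++ D (Suc n))" using \<gamma> D' join by (intro arc_join) auto
    moreover have im: "path_image (\<gamma> +++ D (Suc n)) = (\<Union>m\<le>Suc n. path_image (d (g m)))"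
      using path_image_join[OF join] \<gamma>(4) D' by (auto simp: atMost_Suc)
    moreover have "winding_number (\<gamma> +++ D (Suc n)) w = (\<Sum>m\<le>Suc n. wn w m)"
      if "w \<notin> path_image (\<gamma> +++ D (Suc n))" for w
    proof -
      have "w \<notin> path_image \<gamma>" "w \<notin> path_image (D (Suc n))"
        using that path_image_join[OF join] by auto
      then show ?thesis
        using \<gamma> D' join wD[of "Suc n" w] by (subst winding_number_join) (auto simp: arc_imp_path)
    qed
    ultimately show ?case using \<gamma> D' by (intro exI[of _ "\<gamma> +++ D (Suc n)"]) auto
  qed
  from this[of "N - 2"] N obtain \<gamma> where \<gamma>: "arc \<gamma>" "pathstart \<gamma> = p (z 0)" "pathfinish \<gamma> = p (z (N - 1))"
      "path_image \<gamma> = (\<Union>m\<le>N-2. path_image (d (g m)))"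
      "\<And>w. w \<notin> path_image \<gamma> \<Longrightarrow> winding_number \<gamma> w = (\<Sum>m\<le>N-2. wn w m)"
    by (auto simp: Suc_diff_Suc numeral_2_eq_2)
  have N1: "N - 1 < N" "Suc (N - 1) = N" "{..<N} = insert (N - 1) {..N-2}" "N - 1 \<notin> {..N-2}" using N by auto
  note D' = D[OF N1(1), unfolded N1(2) z(2)]
  have join: "pathfinish \<gamma> = pathstart (D (N - 1))" "pathfinish (D (N - 1)) = pathstart \<gamma>"
    using D' \<gamma> by simp_all
  have "path_image \<gamma> \<inter> path_image (D (N - 1)) \<subseteq> {pathstart \<gamma>, pathstart (D (N - 1))}"
  proof
    fix w assume w: "w \<in> path_image \<gamma> \<inter> path_image (D (N - 1))"
    then obtain m where m: "m \<le> N - 2" "w \<in> path_image (d (g m))" using \<gamma> by auto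
    then obtain v where v: "w = p v" "v \<in> {z (N - 1), z 0}"
      using meet[of m "N - 1" w] w D' N1 z(2) N by auto
    then show "w \<in> {pathstart \<gamma>, pathstart (D (N - 1))}" using \<gamma> D' by auto
  qed
  then have "simple_path (\<gamma> +++ D (N - 1))"
    using \<gamma> D' join by (intro simple_path_join_loop) auto
  moreover have "path_image (\<gamma> +++ D (N - 1)) = (\<Union>n<N. path_image (d (g n)))"
    using path_image_join[OF join(1)] \<gamma>(4) D' by (auto simp: N1(3))
  moreover have "winding_number (\<gamma> +++ D (N - 1)) w = (\<Sum>n<N. wn w n)"
    if "w \<notin> path_image (\<gamma> +++ D (N - 1))" for w
  proof -
    have "w \<notin> path_image \<gamma>" "w \<notin> path_image (D (N - 1))"
      using that path_image_join[OF join(1)] by auto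
    then show ?thesis
      using \<gamma> D' join(1) wD[OF N1(1), of w] N1(4)
      by (subst winding_number_join) (auto simp: arc_imp_path N1(3))
  qed
  moreover have "pathfinish (\<gamma> +++ D (N - 1)) = pathstart (\<gamma> +++ D (N - 1))"
    using join by simp
  ultimately show ?thesis using that[of "\<gamma> +++ D (N - 1)"] unfolding wn_def by blast
qed

text \<open>The map \<open>\<psi>\<close> leaves a vertex of X by its \<open>i\<close>-edge and a
  vertex of Y by its \<open>j\<close>-edge. It is injective on a finite set, so the orbit of
  \<open>v\<close> returns to \<open>v\<close> and is the vertex set of the Kempe cycle. Going from
  X to Y along \<open>i\<close> and back along \<open>j\<close> is the direction recorded by the
  signs of \<open>colour_chain\<close>.\<close>

lemma Kempe_cycle:
  assumes f: "factorization F C f" and ij: "i \<in> C" "j \<in> C" "i \<noteq> j" and v: "v \<in> X \<union> Y"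
  obtains S K \<gamma> where "v \<in> S" "K \<subseteq> F" "\<And>e. e \<in> K \<Longrightarrow> f e \<in> {i, j}"
    "\<And>e u. e \<in> K \<Longrightarrow> inc e u \<Longrightarrow> u \<in> S"
    "\<And>e u. e \<in> F \<Longrightarrow> f e \<in> {i, j} \<Longrightarrow> inc e u \<Longrightarrow> u \<in> S \<Longrightarrow> e \<in> K"
    "simple_path \<gamma>" "pathfinish \<gamma> = pathstart \<gamma>" "path_image \<gamma> = (\<Union>e\<in>K. path_image (d e))"
    "\<And>w. w \<notin> path_image \<gamma> \<Longrightarrow> winding_number \<gamma> w =
       (\<Sum>e\<in>K. of_int (colour_chain F f i j e) * winding_number (d e) w)"
proof -
  define c where "c u = (if u \<in> X then i else j)" for u
  have cC: "c u \<in> C" for u using ij by (simp add: c_def)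
  have "\<exists>e. e \<in> F \<and> inc e u \<and> f e = c u" if "u \<in> X \<union> Y" for u
    using factorization_edge[OF f that cC] by blast
  then obtain en where en: "\<And>u. u \<in> X \<union> Y \<Longrightarrow> en u \<in> F \<and> inc (en u) u \<and> f (en u) = c u"
    by metis
  have FE: "F \<subseteq> E" using f by (simp add: factorization_def)
  \<comment> \<open>Outside the vertices \<open>\<psi>\<close> is the identity, which makes it
    injective on the whole type, as \<open>funpow_inj_finite\<close> demands.\<close>
  define \<psi> where "\<psi> u = (if u \<in> X then hy (en u) else if u \<in> Y then hx (en u) else u)" for u
  have \<psi>X: "hx (en u) = u" "\<psi> u = hy (en u)" "\<psi> u \<in> Y" "f (en u) = i" if "u \<in> X" for u
    using that en[of u] inc_X[of "en u" u] FE hy by (auto simp: \<psi>_def c_def)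
  have \<psi>Y: "hy (en u) = u" "\<psi> u = hx (en u)" "\<psi> u \<in> X" "f (en u) = j" if "u \<in> Y" for u
    using that en[of u] inc_Y[of "en u" u] FE hx disjXY by (auto simp: \<psi>_def c_def)
  have \<psi>V: "\<psi> u \<in> X \<union> Y" if "u \<in> X \<union> Y" for u using that \<psi>X \<psi>Y by auto
  have en_inj: "u = u'" if "u \<in> X \<union> Y" "u' \<in> X \<union> Y" "en u = en u'" for u u'
    using that \<psi>X[of u] \<psi>Y[of u] \<psi>X[of u'] \<psi>Y[of u'] ij(3) by (metis UnE)
  have "inj \<psi>"
  proof (rule injI)
    fix u u' assume eq: "\<psi> u = \<psi> u'"
    have side: "\<psi> w \<in> Y \<longleftrightarrow> w \<in> X" "\<psi> w \<in> X \<longleftrightarrow> w \<in> Y" for w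
    proof -
      consider "w \<in> X" | "w \<in> Y" | "w \<notin> X \<union> Y" by blast
      then have "(\<psi> w \<in> Y \<longleftrightarrow> w \<in> X) \<and> (\<psi> w \<in> X \<longleftrightarrow> w \<in> Y)"
        using \<psi>X(3)[of w] \<psi>Y(3)[of w] disjXY by cases (blast, blast, simp add: \<psi>_def)
      then show "\<psi> w \<in> Y \<longleftrightarrow> w \<in> X" "\<psi> w \<in> X \<longleftrightarrow> w \<in> Y" by blast+
    qed
    have "u \<in> X \<longleftrightarrow> u' \<in> X" "u \<in> Y \<longleftrightarrow> u' \<in> Y"
      using side[of u] side[of u'] eq by simp_all
    then consider "u \<in> X" "u' \<in> X" | "u \<in> Y" "u' \<in> Y" | "u \<notin> X \<union> Y" "u' \<notin> X \<union> Y"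
      by blast
    then show "u = u'"
    proof cases
      case 1
      have "inc (en u) (\<psi> u)" "inc (en u') (\<psi> u)"
        using \<psi>X(2)[OF 1(1)] \<psi>X(2)[OF 1(2)] eq by (simp_all add: inc_def)
      moreover have "f (en u) = f (en u')" using \<psi>X(4) 1 by simp
      moreover have V: "u \<in> X \<union> Y" "u' \<in> X \<union> Y" using 1 by auto
      ultimately have "en u = en u'"
        using factorization_inj[OF f, of "en u" "en u'" "\<psi> u"] en by blast
      then show ?thesis using en_inj V by blast
    next
      case 2
      have "inc (en u) (\<psi> u)" "inc (en u') (\<psi> u)"
        using \<psi>Y(2)[OF 2(1)] \<psi>Y(2)[OF 2(2)] eq by (simp_all add: inc_def)
      moreover have "f (en u) = f (en u')" using \<psi>Y(4) 2 by simp
      moreover have V: "u \<in> X \<union> Y" "u' \<in> X \<union> Y" using 2 by auto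
      ultimately have "en u = en u'"
        using factorization_inj[OF f, of "en u" "en u'" "\<psi> u"] en by blast
      then show ?thesis using en_inj V by blast
    next
      case 3
      then show ?thesis using eq by (auto simp: \<psi>_def)
    qed
  qed
  define z where "z n = (\<psi> ^^ n) v" for n
  have zV: "z n \<in> X \<union> Y" for n by (induction n) (use v \<psi>V in \<open>auto simp: z_def\<close>)
  have "{y. \<exists>n. y = (\<psi> ^^ n) v} \<subseteq> X \<union> Y"
    using zV by (fastforce simp only: z_def)
  then have "finite {y. \<exists>n. y = (\<psi> ^^ n) v}"
    using finX finY finite_subset by blast
  then obtain n0 where "n0 > 0" "(\<psi> ^^ n0) v = v"
    using funpow_inj_finite[OF \<open>inj \<psi>\<close>] by blast
  then have "\<exists>n>0. z n = v"
    unfolding z_def by blast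
  define N where "N = (LEAST n. n > 0 \<and> z n = v)"
  have N: "N > 0" "z N = v" "\<And>m. 0 < m \<Longrightarrow> m < N \<Longrightarrow> z m \<noteq> v"
    using LeastI_ex[OF \<open>\<exists>n>0. z n = v\<close>] not_less_Least[of _ "\<lambda>n. n > 0 \<and> z n = v"]
    unfolding N_def by auto
  have zinj: "inj_on z {..<N}"
    using inj_on_funpow_least[of N \<psi> v] N unfolding z_def by (simp add: atLeast0LessThan)
  have zS: "z (Suc n) = \<psi> (z n)" for n by (simp add: z_def)
  have z0: "z 0 = v" by (simp add: z_def)
  have "N \<noteq> 1"
  proof
    assume "N = 1"
    then have "\<psi> v = v" using N(2) z0 zS[of 0] by simp
    then show False using v \<psi>X(3)[of v] \<psi>Y(3)[of v] disjXY by auto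
  qed
  then have N2: "N \<ge> 2" using N(1) by linarith
  have ends: "hx (en (z n)) = z n \<and> hy (en (z n)) = z (Suc n) \<or> hy (en (z n)) = z n \<and> hx (en (z n)) = z (Suc n)" for n
    using zV[of n] \<psi>X[of "z n"] \<psi>Y[of "z n"] zS[of n] by auto
  have ginj: "inj_on (\<lambda>n. en (z n)) {..<N}"
    using zinj en_inj zV by (auto simp: inj_on_def)
  have gE: "en (z n) \<in> E" for n using en zV FE by blast
  obtain \<gamma> where \<gamma>: "simple_path \<gamma>" "pathfinish \<gamma> = pathstart \<gamma>"
    "path_image \<gamma> = (\<Union>n<N. path_image (d (en (z n))))"
    "\<And>w. w \<notin> path_image \<gamma> \<Longrightarrow> winding_number \<gamma> w =
       (\<Sum>n<N. (if hx (en (z n)) = z n then 1 else -1) * winding_number (d (en (z n))) w)"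
    using closed_walk_simple_path[OF N2, of "\<lambda>n. en (z n)" z] gE ends zinj N(2) z0 ginj by auto
  define S where "S = z ` {..<N}"
  define K where "K = (\<lambda>n. en (z n)) ` {..<N}"
  have zSuc: "z (Suc n) \<in> S" if "n < N" for n
  proof (cases "Suc n = N")
    case True
    then have "z (Suc n) = z 0" using N(2) z0 by simp
    then show ?thesis using N(1) by (simp add: S_def)
  next
    case False
    then show ?thesis using that by (simp add: S_def)
  qed
  show thesis
  proof (rule that[of S K \<gamma>])
    show "v \<in> S" using z0 N(1) by (auto simp: S_def)
    show "K \<subseteq> F" using en zV by (auto simp: K_def)
    show "f e \<in> {i, j}" if "e \<in> K" for e
      using that en zV by (auto simp: K_def c_def)
    show "u \<in> S" if "e \<in> K" "inc e u" for e u
    proof -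
      obtain n where n: "n < N" "e = en (z n)" using \<open>e \<in> K\<close> by (auto simp: K_def)
      then have "u = z n \<or> u = z (Suc n)" using ends[of n] \<open>inc e u\<close> by (auto simp: inc_def)
      then show ?thesis using n zSuc by (auto simp: S_def)
    qed
    show "e \<in> K" if e: "e \<in> F" "f e \<in> {i, j}" "inc e u" "u \<in> S" for e u
    proof -
      obtain n where n: "n < N" "u = z n" using e by (auto simp: S_def)
      obtain m where m: "m < N" "u = z (Suc m)"
      proof (cases n)
        case 0
        then show ?thesis using that[of "N - 1"] n N z0 by simp
      next
        case (Suc m)
        then show ?thesis using that[of m] n by simp
      qed
      have un: "en u \<in> F" "inc (en u) u" using en[of u] zV n by auto
      have um: "en (z m) \<in> F" "inc (en (z m)) u" using en[of "z m"] zV ends[of m] m by (auto simp: inc_def)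
      \<comment> \<open>The edges by which the walk leaves and enters \<open>u\<close> have the two
        different colours, so no further edge of these colours is left at \<open>u\<close>.\<close>
      have "{f (en u), f (en (z m))} = {i, j}"
      proof (cases "z m \<in> X")
        case True
        then show ?thesis using \<psi>X(3,4)[of "z m"] \<psi>Y(4)[of u] m(2) zS[of m] by auto
      next
        case False
        then have "z m \<in> Y" using zV by blast
        then show ?thesis using \<psi>Y(3,4)[of "z m"] \<psi>X(4)[of u] m(2) zS[of m] by auto
      qed
      then have "f e = f (en u) \<or> f e = f (en (z m))" using e by auto
      then have "e = en u \<or> e = en (z m)"
        using factorization_inj[OF f e(1) un(1) e(3) un(2)] factorization_inj[OF f e(1) um(1) e(3) um(2)] by blast
      then show ?thesis using n m by (auto simp: K_def)
    qed
    show "simple_path \<gamma>" "pathfinish \<gamma> = pathstart \<gamma>" by fact+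
    show "path_image \<gamma> = (\<Union>e\<in>K. path_image (d e))" using \<gamma>(3) by (auto simp: K_def)
    show "winding_number \<gamma> w = (\<Sum>e\<in>K. of_int (colour_chain F f i j e) * winding_number (d e) w)"
      if "w \<notin> path_image \<gamma>" for w
    proof -
      have "(if hx (en (z n)) = z n then 1 else -1 :: complex) = of_int (colour_chain F f i j (en (z n)))" for n
      proof (cases "z n \<in> X")
        case True
        then show ?thesis
          using \<psi>X(1,4)[OF True] en[OF zV[of n]] ij(3) by (simp add: colour_chain_def)
      next
        case False
        then have "z n \<in> Y" "hx (en (z n)) \<noteq> z n" using zV[of n] hx[OF gE[of n]] by auto
        then show ?thesis
          using \<psi>Y(4)[of "z n"] en[OF zV[of n]] ij(3) by (simp add: colour_chain_def)
      qed
      then show ?thesis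
        unfolding K_def sum.reindex[OF ginj] using \<gamma>(4)[OF that] by simp
    qed
  qed
qed

end

section \<open>Levels and turns\<close>

lemma frequently_at_within_closure:
  assumes "x \<in> closure A" "x \<notin> A" "A \<subseteq> B"
  shows "\<exists>\<^sub>F z in at x within B. z \<in> A"
proof -
  have "\<exists>\<^sub>F z in at x. z \<in> A"
    using assms by (auto simp: closure_def islimpt_conv_frequently_at)
  then show ?thesis
    unfolding frequently_def eventually_at_filter
    by (rule contrapos_nn) (auto elim!: eventually_mono dest: subsetD[OF assms(3)])
qed

lemma frequently_eventually_ex:
  assumes "\<exists>\<^sub>F z in A. P z" "\<forall>\<^sub>F z in A. Q z"
  shows "\<exists>z. P z \<and> Q z"
  using frequently_ex[OF frequently_eventually_conj[OF assms]] by blast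

lemma card_3_third:
  assumes "card C = 3" "i \<in> C" "j \<in> C" "i \<noteq> j"
  obtains l where "C = {i, j, l}" "l \<noteq> i" "l \<noteq> j"
proof -
  have "finite C" using assms(1) card.infinite by fastforce
  then have "card (C - {i, j}) = 1"
    using assms by (simp add: card_Diff_subset)
  then obtain l where "C - {i, j} = {l}" by (auto simp: card_1_singleton_iff)
  then have "C = {i, j, l}" "l \<noteq> i" "l \<noteq> j" using assms(2,3) by blast+
  then show ?thesis by (rule that)
qed

lemma of_bool_parity:
  fixes a b :: int
  assumes "a + of_bool P = b + of_bool Q"
  shows "P = Q \<longleftrightarrow> (odd a \<longleftrightarrow> odd b)"
proof -
  have "odd (a + of_bool P) \<longleftrightarrow> odd (b + of_bool Q)" using assms by simp
  then show ?thesis by (cases P; cases Q) (simp_all only: of_bool_eq add_0_right odd_add odd_one simp_thms)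
qed

context plane_bigraph begin

text \<open>On the edge itself \<open>winding_number\<close> is a junk value, so the edge has to be cut out of the filter.\<close>

definition edge_filter :: "'e \<Rightarrow> complex filter" where
  "edge_filter e = at (mid e) within (- path_image (d e))"

text \<open>An arc comes without named sides. Recording only that two consecutive values occur
  arbitrarily near the midpoint avoids choosing a side, and still determines
  \<open>m\<close>.\<close>

definition jump :: "('e \<Rightarrow> int) \<Rightarrow> 'e \<Rightarrow> int \<Rightarrow> bool" where
  "jump k e m \<longleftrightarrow> (\<forall>\<^sub>F z in edge_filter e. winding k z = of_int m \<or> winding k z = of_int (m + 1)) \<and>
     (\<exists>\<^sub>F z in edge_filter e. winding k z = of_int m) \<and>
     (\<exists>\<^sub>F z in edge_filter e. winding k z = of_int (m + 1))"

lemma jump_unique: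
  assumes "jump k e m" "jump k e n"
  shows "m = n"
proof -
  have ev: "\<forall>\<^sub>F z in edge_filter e. winding k z = of_int n \<or> winding k z = of_int (n + 1)"
    and fr: "\<exists>\<^sub>F z in edge_filter e. winding k z = of_int m" "\<exists>\<^sub>F z in edge_filter e. winding k z = of_int (m + 1)"
    using assms unfolding jump_def by auto
  obtain z where "winding k z = of_int m" "winding k z = of_int n \<or> winding k z = of_int (n + 1)"
    using frequently_eventually_ex[OF fr(1) ev] by blast
  moreover obtain w where "winding k w = of_int (m + 1)" "winding k w = of_int n \<or> winding k w = of_int (n + 1)"
    using frequently_eventually_ex[OF fr(2) ev] by blast
  ultimately show ?thesis
    by (auto simp only: of_int_eq_iff)
qed

lemma eventually_edge_filter: "\<forall>\<^sub>F z in nhds (mid e). P z \<Longrightarrow> \<forall>\<^sub>F z in edge_filter e. P z"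
  unfolding edge_filter_def eventually_at_filter by (erule eventually_mono) simp

lemma winding_eventually_edge_filter:
  assumes "cycle_chain k" "e \<in> E" "k e = 0"
  shows "\<forall>\<^sub>F z in edge_filter e. winding k z = winding k (mid e)"
  using assms by (intro eventually_edge_filter winding_eventually_const mid_supp)

lemma jump_shift:
  assumes "jump k e m" "\<forall>\<^sub>F z in edge_filter e. winding k z = winding l z + of_int r"
  shows "jump l e (m - r)"
proof -
  have shift: "(\<exists>\<^sub>F z in edge_filter e. winding l z = of_int (n - r))" if "\<exists>\<^sub>F z in edge_filter e. winding k z = of_int n" for n
    using frequently_eventually_conj[OF that assms(2)] by (rule frequently_elim1) (auto simp: algebra_simps)
  have "\<forall>\<^sub>F z in edge_filter e. winding l z = of_int (m - r) \<or> winding l z = of_int (m - r + 1)"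
    using conjunct1[OF assms(1)[unfolded jump_def]] assms(2)
    by eventually_elim (auto simp: algebra_simps)
  moreover have "m + 1 - r = m - r + 1" by simp
  ultimately show ?thesis
    using assms(1) shift[of m] shift[of "m + 1"] unfolding jump_def by metis
qed

text \<open>The chain splits into the Kempe cycle through \<open>v\<close> and a remainder
  \<open>kr\<close> that vanishes on every edge at a vertex of that cycle. The remainder therefore
  has one integer value \<open>r\<close> at \<open>p v\<close> and at the midpoints of all edges
  there, while by the Jordan curve theorem the cycle adds 0 outside and a constant sign inside.
  Hence one \<open>m\<close> serves all edges at \<open>v\<close>.\<close>

lemma jump_exists:
  assumes f: "factorization F C f" and ij: "i \<in> C" "j \<in> C" "i \<noteq> j" and v: "v \<in> X \<union> Y"
  defines "k \<equiv> colour_chain F f i j"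
  shows "\<exists>m. (\<forall>e\<in>F. inc e v \<and> f e \<in> {i, j} \<longrightarrow> jump k e m) \<and>
    (\<forall>e\<in>F. inc e v \<and> f e \<notin> {i, j} \<longrightarrow> winding k (mid e) = of_int m \<or> winding k (mid e) = of_int (m + 1))"
proof -
  obtain S K \<gamma> where vS: "v \<in> S" and KF: "K \<subseteq> F" and Kf: "\<And>e. e \<in> K \<Longrightarrow> f e \<in> {i, j}"
    and KS: "\<And>e u. e \<in> K \<Longrightarrow> inc e u \<Longrightarrow> u \<in> S"
    and SK: "\<And>e u. e \<in> F \<Longrightarrow> f e \<in> {i, j} \<Longrightarrow> inc e u \<Longrightarrow> u \<in> S \<Longrightarrow> e \<in> K"
    and \<gamma>: "simple_path \<gamma>" "pathfinish \<gamma> = pathstart \<gamma>" "path_image \<gamma> = (\<Union>e\<in>K. path_image (d e))"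
    and w\<gamma>: "\<And>w. w \<notin> path_image \<gamma> \<Longrightarrow> winding_number \<gamma> w =
       (\<Sum>e\<in>K. of_int (colour_chain F f i j e) * winding_number (d e) w)"
    by (rule Kempe_cycle[OF f ij v]) (rule that)
  have FE: "F \<subseteq> E" using f by (simp add: factorization_def)
  have k_nz: "e \<in> F \<and> f e \<in> {i, j}" if "k e \<noteq> 0" for e
    using that by (auto simp: k_def colour_chain_def split: if_splits)
  define kr where "kr e = (if e \<in> K then 0 else k e)" for e
  have kr0: "kr e = 0" if "inc e u" "u \<in> S" for e u
    using SK[of e u] k_nz[of e] that by (auto simp: kr_def)
  have "cycle_chain k" unfolding k_def using cycle_chain_colour_chain[OF f ij(1,2)] .
  have kr: "cycle_chain kr"
    unfolding cycle_chain_def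
  proof
    fix u assume u: "u \<in> X \<union> Y"
    show "(\<Sum>e | e \<in> E \<and> inc e u. kr e) = 0"
    proof (cases "u \<in> S")
      case True
      then show ?thesis using kr0 by (intro sum.neutral) auto
    next
      case False
      then have "(\<Sum>e | e \<in> E \<and> inc e u. kr e) = (\<Sum>e | e \<in> E \<and> inc e u. k e)"
        using KS by (intro sum.cong) (auto simp: kr_def)
      then show ?thesis using \<open>cycle_chain k\<close> u by (simp add: cycle_chain_def)
    qed
  qed
  have Wk: "winding k z = winding kr z + winding_number \<gamma> z" if "z \<notin> path_image \<gamma>" for z
  proof -
    have "winding k z - winding kr z = (\<Sum>e\<in>E. of_int (k e - kr e) * winding_number (d e) z)"
      by (simp add: winding_def sum_subtractf left_diff_distrib)
    also have "\<dots> = (\<Sum>e\<in>K. of_int (k e) * winding_number (d e) z)"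
      using KF FE finE by (intro sum.mono_neutral_cong_right) (auto simp: kr_def)
    finally have "winding k z - winding kr z = winding_number \<gamma> z" using w\<gamma>[OF that] by (simp only: k_def)
    then show ?thesis by (simp add: diff_eq_eq add.commute)
  qed
  obtain s :: int where s: "s = 1 \<or> s = -1" and ins: "\<And>z. z \<in> inside (path_image \<gamma>) \<Longrightarrow> winding_number \<gamma> z = of_int s"
  proof (rule simple_closed_path_winding_number_inside[OF \<gamma>(1)])
    assume "\<And>z. z \<in> inside (path_image \<gamma>) \<Longrightarrow> winding_number \<gamma> z = 1"
    then show thesis using that[of 1] by simp
  next
    assume "\<And>z. z \<in> inside (path_image \<gamma>) \<Longrightarrow> winding_number \<gamma> z = -1"
    then show thesis using that[of "-1"] by simp
  qed
  have outs: "\<And>z. z \<in> outside (path_image \<gamma>) \<Longrightarrow> winding_number \<gamma> z = 0"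
    using winding_number_zero_in_outside[OF _ \<gamma>(2)] \<gamma>(1) simple_path_imp_path by blast
  have cases: "winding_number \<gamma> z = 0 \<or> winding_number \<gamma> z = of_int s" if "z \<notin> path_image \<gamma>" for z
    using that ins outs inside_Un_outside[of "path_image \<gamma>"] by blast
  have "p v \<notin> supp kr"
    using kr0[OF _ vS] vertex_on_d v unfolding supp_def by blast
  then have "winding kr (p v) \<in> \<int>" by (rule winding_int[OF kr])
  then obtain r where r: "winding kr (p v) = of_int r" by (auto elim: Ints_cases)
  have Wr: "winding kr (mid e) = of_int r" if "e \<in> F" "inc e v" for e
    using winding_half_edge[OF kr, of e v] that FE kr0[OF _ vS] r by auto
  \<comment> \<open>The two values are \<open>r\<close> and \<open>r + s\<close> with
    \<open>s = 1\<close> or \<open>s = -1\<close>; \<open>m\<close> is the smaller one.\<close>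
  define m where "m = r + min 0 s"
  have m: "(of_int r :: complex) = of_int m \<or> (of_int r :: complex) = of_int (m + 1)"
     "(of_int r + of_int s :: complex) = of_int m \<or> (of_int r + of_int s :: complex) = of_int (m + 1)"
    using s by (auto simp: m_def)
  have "jump k e m" if e: "e \<in> F" "inc e v" "f e \<in> {i, j}" for e
  proof -
    have eK: "e \<in> K" "e \<in> E" using SK[OF e(1,3,2) vS] e FE by auto
    have "\<forall>\<^sub>F z in nhds (mid e). z \<in> - (\<Union>e'\<in>K - {e}. path_image (d e'))"
    proof (rule eventually_nhds_in_open)
      have "finite (K - {e})" using KF FE finE finite_subset by (metis finite_Diff)
      then show "open (- (\<Union>e'\<in>K - {e}. path_image (d e')))"
        using KF FE path_d by (intro open_Compl closed_UN) (auto intro!: closed_path_image)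
      show "mid e \<in> - (\<Union>e'\<in>K - {e}. path_image (d e'))"
        using mid_not_on[of e] eK KF FE by auto
    qed
    then have "\<forall>\<^sub>F z in edge_filter e. z \<in> - (\<Union>e'\<in>K - {e}. path_image (d e'))"
      by (rule eventually_edge_filter)
    moreover have "\<forall>\<^sub>F z in edge_filter e. z \<notin> path_image (d e)"
      unfolding edge_filter_def eventually_at_filter by auto
    moreover have "\<forall>\<^sub>F z in edge_filter e. winding kr z = of_int r"
      using winding_eventually_edge_filter[OF kr eK(2) kr0[OF e(2) vS]] Wr[OF e(1,2)] by simp
    ultimately have ev: "\<forall>\<^sub>F z in edge_filter e. z \<notin> path_image \<gamma> \<and> winding k z = of_int r + winding_number \<gamma> z"
    proof eventually_elim
      case (elim z)
      then have "z \<notin> path_image \<gamma>" using \<gamma>(3) by auto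
      then show ?case using Wk elim by auto
    qed
    \<comment> \<open>Inside and outside both have the whole curve as frontier, so both come
      arbitrarily close to \<open>mid e\<close>, and each of the two values occurs there.\<close>
    note J = Jordan_inside_outside[OF \<gamma>(1,2)]
    have mid: "mid e \<in> path_image \<gamma>" using \<gamma>(3) eK mid_on by blast
    have fr: "\<exists>\<^sub>F z in edge_filter e. z \<in> A" if "frontier A = path_image \<gamma>" "A \<subseteq> - path_image \<gamma>" for A
      unfolding edge_filter_def
    proof (rule frequently_at_within_closure)
      show "mid e \<in> closure A" using mid that(1) by (auto simp: frontier_def)
      show "mid e \<notin> A" using mid that(2) by blast
      show "A \<subseteq> - path_image (d e)" using that(2) \<gamma>(3) eK by blast
    qed
    have sub: "inside (path_image \<gamma>) \<subseteq> - path_image \<gamma>" "outside (path_image \<gamma>) \<subseteq> - path_image \<gamma>"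
      using inside_Un_outside[of "path_image \<gamma>"] by blast+
    have "frontier (inside (path_image \<gamma>)) = path_image \<gamma>" using J by blast
    then have "\<exists>\<^sub>F z in edge_filter e. z \<in> inside (path_image \<gamma>)"
      using sub(1) by (rule fr)
    from frequently_eventually_conj[OF this ev]
    have f1: "\<exists>\<^sub>F z in edge_filter e. winding k z = of_int r + of_int s"
      by (rule frequently_elim1) (simp add: ins)
    have "frontier (outside (path_image \<gamma>)) = path_image \<gamma>" using J by blast
    then have "\<exists>\<^sub>F z in edge_filter e. z \<in> outside (path_image \<gamma>)"
      using sub(2) by (rule fr)
    from frequently_eventually_conj[OF this ev]
    have f2: "\<exists>\<^sub>F z in edge_filter e. winding k z = of_int r"
      by (rule frequently_elim1) (simp add: outs)
    have "\<forall>\<^sub>F z in edge_filter e. winding k z = of_int m \<or> winding k z = of_int (m + 1)"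
      using ev
    proof (rule eventually_mono)
      fix z assume z: "z \<notin> path_image \<gamma> \<and> winding k z = of_int r + winding_number \<gamma> z"
      then have "winding k z = of_int r \<or> winding k z = of_int r + of_int s" using cases[of z] by auto
      then show "winding k z = of_int m \<or> winding k z = of_int (m + 1)" using m by metis
    qed
    moreover have "(\<exists>\<^sub>F z in edge_filter e. winding k z = of_int m) \<and> (\<exists>\<^sub>F z in edge_filter e. winding k z = of_int (m + 1))"
      using s
    proof
      assume "s = 1"
      then show ?thesis using f1 f2 by (simp add: m_def)
    next
      assume "s = -1"
      then show ?thesis using f1 f2 by (simp add: m_def)
    qed
    ultimately show ?thesis unfolding jump_def by blast
  qed
  moreover have "winding k (mid e) = of_int m \<or> winding k (mid e) = of_int (m + 1)"
    if e: "e \<in> F" "inc e v" "f e \<notin> {i, j}" for e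
  proof -
    have "mid e \<notin> path_image \<gamma>"
      using mid_not_on[of e] e Kf KF FE unfolding \<gamma>(3) by blast
    then have "winding k (mid e) = of_int r \<or> winding k (mid e) = of_int r + of_int s"
      using Wk[of "mid e"] Wr[OF e(1,2)] cases[of "mid e"] by auto
    then show ?thesis using m by metis
  qed
  ultimately show ?thesis by blast
qed

text \<open>The level of the \<open>(i,j)\<close>-coloured Kempe cycle through \<open>v\<close>: the smaller of the two winding numbers
  next to it. The turn tells whether the third edge at \<open>v\<close> lies on the side of the larger one.\<close>

definition level :: "'e set \<Rightarrow> ('e \<Rightarrow> nat) \<Rightarrow> nat \<Rightarrow> nat \<Rightarrow> 'v \<Rightarrow> int" where
  "level F f i j v = (THE m. \<forall>e\<in>F. inc e v \<and> f e \<in> {i, j} \<longrightarrow> jump (colour_chain F f i j) e m)"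

definition turn :: "'e set \<Rightarrow> ('e \<Rightarrow> nat) \<Rightarrow> nat \<Rightarrow> nat \<Rightarrow> 'v \<Rightarrow> bool" where
  "turn F f i j v \<longleftrightarrow> (\<exists>e\<in>F. inc e v \<and> f e \<notin> {i, j} \<and>
     winding (colour_chain F f i j) (mid e) = of_int (level F f i j v + 1))"

lemma level_eqI:
  assumes f: "factorization F C f" "i \<in> C" "j \<in> C" "i \<noteq> j" and v: "v \<in> X \<union> Y"
    and m: "\<forall>e\<in>F. inc e v \<and> f e \<in> {i, j} \<longrightarrow> jump (colour_chain F f i j) e m"
  shows "level F f i j v = m"
  unfolding level_def
proof (rule the_equality)
  show "\<forall>e\<in>F. inc e v \<and> f e \<in> {i, j} \<longrightarrow> jump (colour_chain F f i j) e m" by fact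
  obtain e where e: "e \<in> F" "inc e v" "f e = i"
    using factorization_edge[OF f(1) v f(2)] by blast
  fix n assume "\<forall>e\<in>F. inc e v \<and> f e \<in> {i, j} \<longrightarrow> jump (colour_chain F f i j) e n"
  then have "jump (colour_chain F f i j) e n" using e by blast
  moreover have "jump (colour_chain F f i j) e m" using m e by blast
  ultimately show "n = m" by (rule jump_unique)
qed

lemma jump_level:
  assumes f: "factorization F C f" "i \<in> C" "j \<in> C" "i \<noteq> j" and e: "e \<in> F" "inc e v" "f e \<in> {i, j}"
  shows "jump (colour_chain F f i j) e (level F f i j v)"
proof -
  have v: "v \<in> X \<union> Y" using f e inc_vertex by (auto simp: factorization_def)
  obtain m where m: "\<forall>e\<in>F. inc e v \<and> f e \<in> {i, j} \<longrightarrow> jump (colour_chain F f i j) e m"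
    using jump_exists[OF f v] by blast
  show ?thesis using level_eqI[OF f v m] m e by blast
qed

lemma winding_third_cases:
  assumes f: "factorization F C f" "i \<in> C" "j \<in> C" "i \<noteq> j" and e: "e \<in> F" "inc e v" "f e \<notin> {i, j}"
  shows "winding (colour_chain F f i j) (mid e) = of_int (level F f i j v)
    \<or> winding (colour_chain F f i j) (mid e) = of_int (level F f i j v + 1)"
proof -
  have v: "v \<in> X \<union> Y" using f e inc_vertex by (auto simp: factorization_def)
  obtain m where m: "\<forall>e\<in>F. inc e v \<and> f e \<in> {i, j} \<longrightarrow> jump (colour_chain F f i j) e m"
    and "\<forall>e\<in>F. inc e v \<and> f e \<notin> {i, j} \<longrightarrow> winding (colour_chain F f i j) (mid e) = of_int m
      \<or> winding (colour_chain F f i j) (mid e) = of_int (m + 1)"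
    using jump_exists[OF f v] by blast
  then show ?thesis unfolding level_eqI[OF f v m] using e by blast
qed

text \<open>The jump belongs to the edge, not to one of its ends. Hence the level is constant along
  a Kempe cycle, and a vertex set described by the level is admissible for
  \<open>Kempe_swap\<close>.\<close>

lemma level_edge:
  assumes f: "factorization F C f" "i \<in> C" "j \<in> C" "i \<noteq> j" and e: "e \<in> F" "f e \<in> {i, j}"
  shows "level F f i j (hx e) = level F f i j (hy e)"
  by (rule jump_unique[OF jump_level[OF f e(1) _ e(2)] jump_level[OF f e(1) _ e(2)]]) simp_all

text \<open>The turn as an integer: the offset of the third edge above the level. With three colours
  this edge is unique at \<open>v\<close>, so the existential in \<open>turn\<close> speaks about
  \<open>e\<close>.\<close>

lemma winding_third:
  assumes f: "factorization F C f" and C: "C = {i, j, l}" "i \<noteq> j" "l \<noteq> i" "l \<noteq> j"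
    and e: "e \<in> F" "inc e v" "f e = l"
  shows "winding (colour_chain F f i j) (mid e) = of_int (level F f i j v + of_bool (turn F f i j v))"
proof -
  let ?winding = "winding (colour_chain F f i j)"
  have ij: "i \<in> C" "j \<in> C" "f e \<notin> {i, j}" using C e by auto
  have "turn F f i j v \<longleftrightarrow> ?winding (mid e) = of_int (level F f i j v + 1)"
  proof
    assume "turn F f i j v"
    then obtain e' where e': "e' \<in> F" "inc e' v" "f e' \<notin> {i, j}" "?winding (mid e') = of_int (level F f i j v + 1)"
      unfolding turn_def by blast
    moreover have "f e' \<in> C" using f e' by (auto simp: factorization_def)
    then have "f e' = f e" using e' C e by auto
    ultimately have "e' = e" using factorization_inj[OF f] e by blast
    then show "?winding (mid e) = of_int (level F f i j v + 1)" using e' by blast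
  next
    assume "?winding (mid e) = of_int (level F f i j v + 1)"
    then show "turn F f i j v" unfolding turn_def using e ij by blast
  qed
  then show ?thesis using winding_third_cases[OF f ij(1,2) C(2) e(1,2) ij(3)] by auto
qed

lemma colour_chain_swap: "winding (colour_chain F f j i) z = - winding (colour_chain F f i j) z"
  by (simp add: winding_def colour_chain_def sum_negf[symmetric] algebra_simps)

text \<open>Negation carries the values \<open>m\<close> and \<open>m + 1\<close> to
  \<open>-m\<close> and \<open>-m - 1\<close>; the smaller one is now the image of the larger, hence
  the shift by one.\<close>

lemma level_swap:
  assumes f: "factorization F C f" "i \<in> C" "j \<in> C" "i \<noteq> j" and v: "v \<in> X \<union> Y"
  shows "level F f j i v = - level F f i j v - 1"
proof (rule level_eqI[OF f(1,3,2) _ v])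
  have neg: "- of_int (level F f i j v) - 1 + 1 = (- of_int (level F f i j v) :: complex)" by simp
  show "\<forall>e\<in>F. inc e v \<and> f e \<in> {j, i} \<longrightarrow> jump (colour_chain F f j i) e (- level F f i j v - 1)"
  proof (intro ballI impI)
    fix e assume e: "e \<in> F" "inc e v \<and> f e \<in> {j, i}"
    then have "jump (colour_chain F f i j) e (level F f i j v)"
      using jump_level[OF f] by blast
    then have L: "\<forall>\<^sub>F z in edge_filter e. winding (colour_chain F f i j) z = of_int (level F f i j v)
        \<or> winding (colour_chain F f i j) z = of_int (level F f i j v + 1)"
      "\<exists>\<^sub>F z in edge_filter e. winding (colour_chain F f i j) z = of_int (level F f i j v)"
      "\<exists>\<^sub>F z in edge_filter e. winding (colour_chain F f i j) z = of_int (level F f i j v + 1)"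
      unfolding jump_def by auto
    show "jump (colour_chain F f j i) e (- level F f i j v - 1)"
      unfolding jump_def colour_chain_swap[of F f j i]
    proof (intro conjI)
      show "\<forall>\<^sub>F z in edge_filter e. - winding (colour_chain F f i j) z = of_int (- level F f i j v - 1)
          \<or> - winding (colour_chain F f i j) z = of_int (- level F f i j v - 1 + 1)"
        using L(1) by eventually_elim auto
      show "\<exists>\<^sub>F z in edge_filter e. - winding (colour_chain F f i j) z = of_int (- level F f i j v - 1)"
        using L(3) by (rule frequently_elim1) simp
      show "\<exists>\<^sub>F z in edge_filter e. - winding (colour_chain F f i j) z = of_int (- level F f i j v - 1 + 1)"
        using L(2) by (rule frequently_elim1) simp
    qed
  qed
qed (use f in auto)

text \<open>The side of the larger winding number becomes the side of the smaller one, while the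
  third edge stays where it is.\<close>

lemma turn_swap:
  assumes f: "factorization F C f" and C: "card C = 3" "i \<in> C" "j \<in> C" "i \<noteq> j" and v: "v \<in> X \<union> Y"
  shows "turn F f j i v \<longleftrightarrow> \<not> turn F f i j v"
proof -
  obtain l where l: "C = {i, j, l}" "l \<noteq> i" "l \<noteq> j" using card_3_third[OF C] by blast
  then have l': "C = {j, i, l}" "j \<noteq> i" "l \<in> C" using C(4) by auto
  obtain e where e: "e \<in> F" "inc e v" "f e = l"
    using factorization_edge[OF f v l'(3)] by blast
  have "(of_int (level F f j i v + of_bool (turn F f j i v)) :: complex)
      = of_int (- (level F f i j v + of_bool (turn F f i j v)))"
    using winding_third[OF f l(1) C(4) l(2,3) e] winding_third[OF f l'(1,2) l(3,2) e] colour_chain_swap[of F f j i "mid e"]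
    by simp
  then have "level F f j i v + of_bool (turn F f j i v) = - (level F f i j v + of_bool (turn F f i j v))"
    by (simp only: of_int_eq_iff)
  then show ?thesis using level_swap[OF f C(2-4) v] by (auto simp: of_bool_def split: if_splits)
qed

text \<open>Next to an edge of colour \<open>l\<close> the cycle \<open>(i,j)\<close> is invisible, while \<open>(j,l)\<close> and \<open>(l,i)\<close> both jump by one
  and the three winding numbers add up to zero. The identity is symmetric in the colours up to the
  turn, so all cyclic pairs have the same turn.\<close>

lemma turn_sum:
  assumes f: "factorization F C f" and C: "C = {i, j, l}" "i \<noteq> j" "l \<noteq> i" "l \<noteq> j" and v: "v \<in> X \<union> Y"
  shows "level F f i j v + level F f j l v + level F f l i v + of_bool (turn F f i j v) = -1"
proof -
  have mem: "i \<in> C" "j \<in> C" "l \<in> C" using C by auto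
  obtain e where e: "e \<in> F" "inc e v" "f e = l" "e \<in> E"
    using factorization_edge[OF f v mem(3)] by blast
  let ?ij = "colour_chain F f i j" and ?jl = "colour_chain F f j l" and ?li = "colour_chain F f l i"
  define w where "w = level F f i j v + of_bool (turn F f i j v)"
  define m where "m = level F f j l v"
  define n where "n = level F f l i v"
  have w: "winding ?ij (mid e) = of_int w"
    using winding_third[OF f C e(1-3)] by (simp add: w_def)
  have "cycle_chain ?ij" using cycle_chain_colour_chain[OF f mem(1,2)] .
  moreover have "?ij e = 0" using e C by (simp add: colour_chain_def)
  ultimately have ev: "\<forall>\<^sub>F z in edge_filter e. winding ?ij z = of_int w"
    using winding_eventually_edge_filter e(4) w by metis
  have jl: "jump ?jl e m"
    unfolding m_def using C e by (intro jump_level[OF f mem(2,3)]) auto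
  have li: "jump ?li e n"
    unfolding n_def using C e by (intro jump_level[OF f mem(3,1)]) auto
  have zero: "winding ?ij z + winding ?jl z + winding ?li z = 0" for z
    by (simp add: winding_def colour_chain_def sum.distrib[symmetric] algebra_simps)
  have "\<forall>\<^sub>F z in edge_filter e. winding ?li z = of_int n \<or> winding ?li z = of_int (n + 1)"
    using li unfolding jump_def by blast
  with ev have ev': "\<forall>\<^sub>F z in edge_filter e. winding ?jl z = of_int (- w - n) \<or> winding ?jl z = of_int (- w - n - 1)"
  proof eventually_elim
    case (elim z)
    then show ?case using zero[of z] by (auto simp: algebra_simps eq_neg_iff_add_eq_0)
  qed
  \<comment> \<open>Both \<open>m\<close> and \<open>m + 1\<close> must be among
    \<open>-w - n - 1\<close> and \<open>-w - n\<close>, which leaves only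
    \<open>m = -w - n - 1\<close>.\<close>
  have fr: "\<exists>\<^sub>F z in edge_filter e. winding ?jl z = of_int m" "\<exists>\<^sub>F z in edge_filter e. winding ?jl z = of_int (m + 1)"
    using jl unfolding jump_def by auto
  obtain z1 where "winding ?jl z1 = of_int m" "winding ?jl z1 = of_int (- w - n) \<or> winding ?jl z1 = of_int (- w - n - 1)"
    using frequently_eventually_ex[OF fr(1) ev'] by blast
  then have "m = - w - n \<or> m = - w - n - 1" by (simp only: of_int_eq_iff)
  moreover obtain z2 where "winding ?jl z2 = of_int (m + 1)" "winding ?jl z2 = of_int (- w - n) \<or> winding ?jl z2 = of_int (- w - n - 1)"
    using frequently_eventually_ex[OF fr(2) ev'] by blast
  then have "m + 1 = - w - n \<or> m + 1 = - w - n - 1" by (simp only: of_int_eq_iff)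
  ultimately have "w + m + n = -1" by linarith
  then show ?thesis by (simp add: w_def m_def n_def)
qed

lemma turn_rotate:
  assumes f: "factorization F C f" and C: "C = {i, j, l}" "i \<noteq> j" "l \<noteq> i" "l \<noteq> j" and v: "v \<in> X \<union> Y"
  shows "turn F f j l v \<longleftrightarrow> turn F f i j v"
proof -
  have "C = {j, l, i}" using C by auto
  then have "level F f j l v + level F f l i v + level F f i j v + of_bool (turn F f j l v) = -1"
    using C by (intro turn_sum[OF f _ _ _ _ v]) auto
  then have "(of_bool (turn F f j l v) :: int) = of_bool (turn F f i j v)"
    using turn_sum[OF f C v] by linarith
  then show ?thesis by (simp only: of_bool_eq_iff)
qed

lemma turn_edge_parity:
  assumes f: "factorization F C f" and C: "C = {i, j, l}" "i \<noteq> j" "l \<noteq> i" "l \<noteq> j" and e: "e \<in> F" "f e = l"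
  shows "turn F f i j (hx e) = turn F f i j (hy e) \<longleftrightarrow> (odd (level F f i j (hx e)) \<longleftrightarrow> odd (level F f i j (hy e)))"
proof -
  have "(of_int (level F f i j (hx e) + of_bool (turn F f i j (hx e))) :: complex)
      = of_int (level F f i j (hy e) + of_bool (turn F f i j (hy e)))"
    using winding_third[OF f C e(1) inc_hx e(2)] winding_third[OF f C e(1) inc_hy e(2)] by simp
  then have "level F f i j (hx e) + of_bool (turn F f i j (hx e)) = level F f i j (hy e) + of_bool (turn F f i j (hy e))"
    by (simp only: of_int_eq_iff)
  then show ?thesis by (rule of_bool_parity)
qed

text \<open>The difference of the two 1-cycles vanishes on all edges at \<open>v\<close>; hence the turn only depends on the
  ordered pair of edges, not on the colouring.\<close>

lemma turn_compare:
  assumes f: "factorization F C f" and g: "factorization F C g" and C: "card C = 3"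
    and e: "e1 \<in> F" "e2 \<in> F" "e1 \<noteq> e2" "inc e1 v" "inc e2 v"
  shows "turn F f (f e1) (f e2) v \<longleftrightarrow> turn F g (g e1) (g e2) v"
proof -
  let ?f = "colour_chain F f (f e1) (f e2)" and ?g = "colour_chain F g (g e1) (g e2)"
  define k where "k e = ?f e - ?g e" for e
  have v: "v \<in> X \<union> Y" using f e inc_vertex by (auto simp: factorization_def)
  have FE: "F \<subseteq> E" using f by (simp add: factorization_def)
  have mem: "f e1 \<in> C" "f e2 \<in> C" "g e1 \<in> C" "g e2 \<in> C" using f g e by (auto simp: factorization_def)
  have ne: "f e1 \<noteq> f e2" "g e1 \<noteq> g e2"
    using factorization_inj[OF f e(1,2,4,5)] factorization_inj[OF g e(1,2,4,5)] e(3) by auto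
  have k: "cycle_chain k"
    unfolding k_def using cycle_chain_colour_chain f g mem by (intro cycle_chain_diff) auto
  have k0: "k e = 0" if "inc e v" for e
  proof (cases "e \<in> F")
    case True
    then have "f e = f e1 \<longleftrightarrow> e = e1" "f e = f e2 \<longleftrightarrow> e = e2" "g e = g e1 \<longleftrightarrow> e = e1" "g e = g e2 \<longleftrightarrow> e = e2"
      using factorization_inj[OF f, of e _ v] factorization_inj[OF g, of e _ v] e that by blast+
    then show ?thesis by (simp add: k_def colour_chain_def)
  qed (simp add: k_def colour_chain_def)
  have "p v \<notin> supp k"
    using k0 vertex_on_d v unfolding supp_def by blast
  then have "winding k (p v) \<in> \<int>" by (rule winding_int[OF k])
  then obtain r where r: "winding k (p v) = of_int r" by (auto elim: Ints_cases)
  have Wr: "winding k (mid e) = of_int r" if "e \<in> F" "inc e v" for e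
    using winding_half_edge[OF k, of e v] that FE k0 r by auto
  have Wd: "winding k z = winding ?f z - winding ?g z" for z unfolding k_def by (rule winding_diff)
  \<comment> \<open>The level and the value at the third midpoint shift by the same
    \<open>r\<close>, so their difference, the turn, does not change.\<close>
  have "level F g (g e1) (g e2) v = level F f (f e1) (f e2) v - r"
  proof (rule level_eqI[OF g mem(3,4) ne(2) v], intro ballI impI)
    fix e assume e': "e \<in> F" "inc e v \<and> g e \<in> {g e1, g e2}"
    then have "e = e1 \<or> e = e2" using factorization_inj[OF g, of e _ v] e by blast
    then have "jump ?f e (level F f (f e1) (f e2) v)"
      using e' by (intro jump_level[OF f mem(1,2) ne(1)]) auto
    moreover have "\<forall>\<^sub>F z in edge_filter e. winding ?f z = winding ?g z + of_int r"
      using winding_eventually_edge_filter[OF k _ k0, of e] e' FE Wr[of e] Wd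
      by (auto simp: algebra_simps elim!: eventually_mono)
    ultimately show "jump ?g e (level F f (f e1) (f e2) v - r)" by (rule jump_shift)
  qed
  moreover obtain l where l: "C = {f e1, f e2, l}" "l \<noteq> f e1" "l \<noteq> f e2"
    using card_3_third[OF C mem(1,2) ne(1)] by blast
  moreover obtain l' where l': "C = {g e1, g e2, l'}" "l' \<noteq> g e1" "l' \<noteq> g e2"
    using card_3_third[OF C mem(3,4) ne(2)] by blast
  moreover obtain e3 where e3: "e3 \<in> F" "inc e3 v" "f e3 = l"
    using factorization_edge[OF f v, of l] l(1) by blast
  moreover have "g e3 = l'"
  proof -
    have "e3 \<noteq> e1" "e3 \<noteq> e2" using e3 l by auto
    then have "g e3 \<noteq> g e1" "g e3 \<noteq> g e2"
      using factorization_inj[OF g, of e3 _ v] e e3 by blast+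
    moreover have "g e3 \<in> C" using g e3 by (auto simp: factorization_def)
    ultimately show ?thesis using l'(1) by blast
  qed
  moreover have "winding ?f (mid e3) = winding ?g (mid e3) + of_int r"
    using Wr[OF e3(1,2)] Wd[of "mid e3"] by (simp add: algebra_simps)
  ultimately have "(of_int (level F f (f e1) (f e2) v + of_bool (turn F f (f e1) (f e2) v)) :: complex)
     = of_int (level F f (f e1) (f e2) v + of_bool (turn F g (g e1) (g e2) v))"
    using winding_third[OF f l(1) ne(1) l(2,3) e3] winding_third[OF g l'(1) ne(2) l'(2,3) e3(1,2)] by simp
  then have "(of_bool (turn F f (f e1) (f e2) v) :: int) = of_bool (turn F g (g e1) (g e2) v)"
    by (simp only: of_int_eq_iff add_left_cancel)
  then show ?thesis by (simp only: of_bool_eq_iff)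
qed

section \<open>Kempe equivalence\<close>

text \<open>The pair of colours is quantified away to make this a property of the edge alone; by
  \<open>nonsingular_iff\<close> any one pair decides it. These edges have to be repaired before the
  colouring becomes rigid.\<close>

definition nonsingular :: "'e set \<Rightarrow> nat set \<Rightarrow> ('e \<Rightarrow> nat) \<Rightarrow> 'e set" where
  "nonsingular F C f = {e \<in> F. \<exists>i\<in>C. \<exists>j\<in>C. i \<noteq> j \<and> turn F f i j (hx e) \<noteq> turn F f i j (hy e)}"

text \<open>Each ordered pair of colours arises from \<open>(i, j)\<close> by rotation, which keeps
  the turn, and reversal, which negates it at both vertices alike.\<close>

lemma turn_pair:
  assumes f: "factorization F C f" and C: "card C = 3" "i \<in> C" "j \<in> C" "i \<noteq> j" "i' \<in> C" "j' \<in> C" "i' \<noteq> j'"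
    and uv: "u \<in> X \<union> Y" "v \<in> X \<union> Y" and eq: "turn F f i j u = turn F f i j v"
  shows "turn F f i' j' u = turn F f i' j' v"
proof -
  obtain l where l: "C = {i, j, l}" "l \<noteq> i" "l \<noteq> j" using card_3_third[OF C(1-4)] by blast
  have C2: "C = {j, l, i}" using l by auto
  have jl: "turn F f j l w \<longleftrightarrow> turn F f i j w" if "w \<in> X \<union> Y" for w
    using turn_rotate[OF f l(1) C(4) l(2,3) that] .
  have li: "turn F f l i w \<longleftrightarrow> turn F f i j w" if "w \<in> X \<union> Y" for w
    using turn_rotate[OF f C2 l(3)[symmetric] C(4) l(2)[symmetric] that] jl[OF that] by blast
  have m: "i \<in> C" "j \<in> C" "l \<in> C" using l by auto
  have sw: "turn F f y x w \<longleftrightarrow> \<not> turn F f x y w" if "x \<in> C" "y \<in> C" "x \<noteq> y" "w \<in> X \<union> Y" for x y w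
    using turn_swap[OF f C(1) that] .
  have "i' \<in> {i, j, l}" "j' \<in> {i, j, l}" using C l(1) by auto
  then consider "i' = i" "j' = j" | "i' = j" "j' = l" | "i' = l" "j' = i"
    | "i' = j" "j' = i" | "i' = l" "j' = j" | "i' = i" "j' = l" using C(7) by blast
  then show ?thesis
  proof cases
    case 1 then show ?thesis using eq by simp
  next
    case 2 then show ?thesis using eq jl uv by simp
  next
    case 3 then show ?thesis using eq li uv by simp
  next
    case 4 then show ?thesis using eq sw[OF m(1,2) C(4)] uv by simp
  next
    case 5 then show ?thesis using eq sw[OF m(2,3) l(3)[symmetric]] jl uv by simp
  next
    case 6 then show ?thesis using eq sw[OF m(3,1) l(2)] li uv by simp
  qed
qed

lemma nonsingular_iff:
  assumes f: "factorization F C f" and C: "card C = 3" "i \<in> C" "j \<in> C" "i \<noteq> j" and e: "e \<in> F"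
  shows "e \<in> nonsingular F C f \<longleftrightarrow> turn F f i j (hx e) \<noteq> turn F f i j (hy e)"
proof -
  have "e \<in> E" using f e by (auto simp: factorization_def)
  then have "hx e \<in> X \<union> Y" "hy e \<in> X \<union> Y" using hx hy by auto
  then show ?thesis
    using turn_pair[OF f C] C e unfolding nonsingular_def by blast
qed

text \<open>By \<open>turn_compare\<close> the turn is a matter of the ordered pair of edges at
  \<open>v\<close>. A swap at \<open>v\<close> gives these edges the two colours in reverse order,
  and reversal negates the turn.\<close>

lemma turn_Kempe_swap:
  assumes f: "factorization F C f" and C: "card C = 3" "i \<in> C" "j \<in> C" "i \<noteq> j"
    and T: "\<And>e. e \<in> F \<Longrightarrow> f e \<in> {i, j} \<Longrightarrow> hx e \<in> T \<longleftrightarrow> hy e \<in> T"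
    and v: "v \<in> X \<union> Y"
  shows "turn F (Kempe_swap F i j T f) i j v \<longleftrightarrow> (turn F f i j v \<noteq> (v \<in> T))"
proof -
  let ?g = "Kempe_swap F i j T f"
  have g: "factorization F C ?g" by (rule factorization_Kempe_swap[OF f C(2,3) T])
  obtain e1 where e1: "e1 \<in> F" "inc e1 v" "f e1 = i" using factorization_edge[OF f v C(2)] by blast
  obtain e2 where e2: "e2 \<in> F" "inc e2 v" "f e2 = j" using factorization_edge[OF f v C(3)] by blast
  have "e1 \<noteq> e2" using e1 e2 C(4) by auto
  then have "turn F f i j v \<longleftrightarrow> turn F ?g (?g e1) (?g e2) v"
    using turn_compare[OF f g C(1) e1(1) e2(1) _ e1(2) e2(2)] e1(3) e2(3) by simp
  moreover have "?g e1 = (if v \<in> T then j else i)" "?g e2 = (if v \<in> T then i else j)"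
    using Kempe_swap_at[OF T e1(1,2)] Kempe_swap_at[OF T e2(1,2)] e1(3) e2(3) by simp_all
  ultimately show ?thesis using turn_swap[OF g C v] by (cases "v \<in> T") simp_all
qed

lemma steps_to_singular:
  assumes f: "factorization F C f" and C: "card C = 3"
  shows "\<exists>g. (step 2 F C)\<^sup>*\<^sup>* f g \<and> nonsingular F C g = {}"
  using f
proof (induction "card (nonsingular F C f)" arbitrary: f rule: less_induct)
  case less
  note f = \<open>factorization F C f\<close>
  show ?case
  proof (cases "nonsingular F C f = {}")
    case True
    then show ?thesis by blast
  next
    case False
    then obtain e where e: "e \<in> nonsingular F C f" by blast
    then have eF: "e \<in> F" by (simp add: nonsingular_def)
    define l where "l = f e"
    have lC: "l \<in> C" using f eF by (auto simp: l_def factorization_def)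
    have "C \<noteq> {l}" using C by auto
    then obtain i where i: "i \<in> C" "i \<noteq> l" using lC by blast
    obtain j where j: "C = {l, i, j}" "j \<noteq> l" "j \<noteq> i"
      using card_3_third[OF C lC i(1)] i(2) by metis
    have C': "C = {i, j, l}" "i \<noteq> j" "l \<noteq> i" "l \<noteq> j" "i \<in> C" "j \<in> C" using i j by auto
    note CC = C C'(5,6,2)
    define T where "T = {v. odd (level F f i j v)}"
    have T: "hx e' \<in> T \<longleftrightarrow> hy e' \<in> T" if "e' \<in> F" "f e' \<in> {i, j}" for e'
      using level_edge[OF f C'(5,6,2) that] by (simp add: T_def)
    define g where "g = Kempe_swap F i j T f"
    have fg: "step 2 F C f g" unfolding g_def by (rule step_Kempe_swap[OF f C'(5,6) T])
    have g: "factorization F C g" using fg by (simp add: step_def)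
    have ns: "e' \<in> nonsingular F C g \<longleftrightarrow> e' \<in> nonsingular F C f \<and> f e' \<noteq> l" if e': "e' \<in> F" for e'
    proof -
      have V: "hx e' \<in> X \<union> Y" "hy e' \<in> X \<union> Y" using hx hy f e' by (auto simp: factorization_def)
      have tg: "e' \<in> nonsingular F C g \<longleftrightarrow>
          (turn F f i j (hx e') \<noteq> (hx e' \<in> T)) \<noteq> (turn F f i j (hy e') \<noteq> (hy e' \<in> T))"
        using nonsingular_iff[OF g CC e'] turn_Kempe_swap[OF f CC T V(1)] turn_Kempe_swap[OF f CC T V(2)]
        unfolding g_def by blast
      have tf: "e' \<in> nonsingular F C f \<longleftrightarrow> turn F f i j (hx e') \<noteq> turn F f i j (hy e')"
        using nonsingular_iff[OF f CC e'] .
      show ?thesis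
      proof (cases "f e' = l")
        case True
        then show ?thesis
          using tg turn_edge_parity[OF f C'(1-4) e' True] unfolding T_def by blast
      next
        case False
        moreover have "f e' \<in> C" using f e' by (auto simp: factorization_def)
        \<comment> \<open>An edge of colour \<open>i\<close> or \<open>j\<close> has both ends on
          one Kempe cycle, so both turns flip or neither does.\<close>
        ultimately have "f e' \<in> {i, j}" using C'(1) by blast
        then show ?thesis using T[OF e'] tg tf False by blast
      qed
    qed
    have "nonsingular F C g \<subset> nonsingular F C f"
    proof
      show "nonsingular F C g \<subseteq> nonsingular F C f"
      proof
        fix e' assume e': "e' \<in> nonsingular F C g"
        then have "e' \<in> F" by (simp add: nonsingular_def)
        then show "e' \<in> nonsingular F C f" using ns e' by blast
      qed
      show "nonsingular F C g \<noteq> nonsingular F C f"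
        using ns[OF eF] e l_def by blast
    qed
    moreover have "F \<subseteq> E" using f by (simp add: factorization_def)
    then have "finite (nonsingular F C f)"
      using finE finite_subset[of "nonsingular F C f" E] by (auto simp: nonsingular_def)
    ultimately have "card (nonsingular F C g) < card (nonsingular F C f)"
      by (intro psubset_card_mono)
    then obtain h where "(step 2 F C)\<^sup>*\<^sup>* g h" "nonsingular F C h = {}"
      using less.hyps g by blast
    then show ?thesis using fg by (meson converse_rtranclp_into_rtranclp)
  qed
qed

text \<open>At each vertex the two colourings give a bijection from \<open>f\<close>-colours to
  \<open>g\<close>-colours; the claim is that both ends of \<open>e\<close> give the same one. They
  agree on the colour of \<open>e\<close>, so otherwise they would differ by a transposition of the
  other two colours, and \<open>g\<close> would have different turns at the ends of
  \<open>e\<close>.\<close>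

lemma singular_transport:
  assumes f: "factorization F C f" "nonsingular F C f = {}" and g: "factorization F C g" "nonsingular F C g = {}"
    and C: "card C = 3" and e: "e \<in> F" "inc e u" "inc e v"
    and e1: "e1 \<in> F" "inc e1 u" and e2: "e2 \<in> F" "inc e2 v" and eq: "f e1 = f e2"
  shows "g e1 = g e2"
proof (cases "u = v")
  case True
  then show ?thesis using factorization_inj[OF f(1) e1(1) e2(1) e1(2)] e2(2) eq by simp
next
  case False
  have FE: "F \<subseteq> E" using f by (simp add: factorization_def)
  have uv: "u \<in> X \<union> Y" "v \<in> X \<union> Y" using e FE inc_vertex by auto
  have turn_eq: "turn F h i j u = turn F h i j v"
    if "factorization F C h" "nonsingular F C h = {}" "i \<in> C" "j \<in> C" "i \<noteq> j" for h i j
  proof -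
    have "turn F h i j (hx e) = turn F h i j (hy e)"
      using nonsingular_iff[OF that(1) C that(3-5) e(1)] that(2) by blast
    then show ?thesis using e(2,3) False unfolding inc_def by metis
  qed
  show ?thesis
  proof (cases "e1 = e \<or> e2 = e")
    case True
    then have "e1 = e2"
      using factorization_inj[OF f(1) e1(1) e2(1) e1(2) _ eq] factorization_inj[OF f(1) e1(1) e2(1) _ e2(2) eq] e
      by blast
    then show ?thesis by simp
  next
    case False
    show ?thesis
    proof (rule ccontr)
      assume neq: "g e1 \<noteq> g e2"
      have mem: "f e \<in> C" "f e1 \<in> C" "g e \<in> C" "g e1 \<in> C" "g e2 \<in> C"
        using f(1) g(1) e e1 e2 by (auto simp: factorization_def)
      have ne: "f e \<noteq> f e1" "g e \<noteq> g e1" "g e \<noteq> g e2"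
        using factorization_inj[OF f(1) e(1) e1(1) e(2) e1(2)]
          factorization_inj[OF g(1) e(1) e1(1) e(2) e1(2)]
          factorization_inj[OF g(1) e(1) e2(1) e(3) e2(2)] False by auto
      have "turn F g (g e) (g e1) u = turn F f (f e) (f e1) u"
        using turn_compare[OF f(1) g(1) C e(1) e1(1) _ e(2) e1(2)] False by blast
      also have "\<dots> = turn F f (f e) (f e2) v"
        using turn_eq[OF f mem(1,2) ne(1)] eq by simp
      also have "\<dots> = turn F g (g e) (g e2) v"
        using turn_compare[OF f(1) g(1) C e(1) e2(1) _ e(3) e2(2)] False by blast
      also have "\<dots> = turn F g (g e2) (g e) v \<longleftrightarrow> False"
        using turn_swap[OF g(1) C mem(3,5) ne(3) uv(2)] by simp
      finally have *: "turn F g (g e) (g e1) u \<noteq> turn F g (g e2) (g e) v"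
        using turn_swap[OF g(1) C mem(3,5) ne(3) uv(2)] by blast
      obtain l where l: "C = {g e, g e1, l}" "l \<noteq> g e" "l \<noteq> g e1"
        using card_3_third[OF C mem(3,4) ne(2)] by blast
      \<comment> \<open>With \<open>g e2\<close> as the third colour, \<open>(g e, g e1)\<close> is
        a rotation of \<open>(g e2, g e)\<close>, which clashes with the turns just
        computed.\<close>
      have le: "l = g e2" using l mem(5) ne(3) neq by auto
      have C2: "C = {g e2, g e, g e1}" using l le by auto
      have "turn F g (g e) (g e1) v = turn F g (g e2) (g e) v"
        using turn_rotate[OF g(1) C2 ne(3)[symmetric] neq ne(2)[symmetric] uv(2)] .
      then show False using * turn_eq[OF g mem(3,4) ne(2)] by simp
    qed
  qed
qed

lemma steps_between_singular:
  assumes "factorization F C f" "nonsingular F C f = {}" and g: "factorization F C g" "nonsingular F C g = {}"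
    and C: "card C = 3" and "\<forall>e. e \<notin> F \<longrightarrow> g e = f e"
  shows "(step 2 F C)\<^sup>*\<^sup>* f g"
  using assms(1,2,6)
proof (induction "card {e \<in> F. f e \<noteq> g e}" arbitrary: f rule: less_induct)
  case less
  note f = less.prems(1,2)
  have FE: "F \<subseteq> E" using f by (simp add: factorization_def)
  show ?case
  proof (cases "\<exists>e\<in>F. f e \<noteq> g e")
    case False
    then have "f = g" using less.prems(3) by (metis ext)
    then show ?thesis by simp
  next
    case True
    then obtain e0 where e0: "e0 \<in> F" "f e0 \<noteq> g e0" by blast
    define i where "i = f e0"
    define j where "j = g e0"
    have ij: "i \<in> C" "j \<in> C" "i \<noteq> j" using f g e0 by (auto simp: factorization_def i_def j_def)
    \<comment> \<open>The vertices at which the bijection from \<open>f\<close>-colours to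
      \<open>g\<close>-colours sends \<open>i\<close> to \<open>j\<close>. By
      \<open>singular_transport\<close> this set is closed under edges of every colour, so it is a
      union of components.\<close>
    define T where "T = {v. \<exists>e\<in>F. inc e v \<and> f e = i \<and> g e = j}"
    have T1: "v \<in> T" if e: "e \<in> F" "inc e u" "inc e v" and u: "u \<in> T" for e u v
    proof -
      obtain e1 where e1: "e1 \<in> F" "inc e1 u" "f e1 = i" "g e1 = j" using u by (auto simp: T_def)
      have "v \<in> X \<union> Y" using e FE inc_vertex by auto
      then obtain e2 where e2: "e2 \<in> F" "inc e2 v" "f e2 = i"
        using factorization_edge[OF f(1) _ ij(1)] by blast
      then have "g e1 = g e2"
        using singular_transport[OF f g C e e1(1,2) e2(1,2)] e1(3) by simp
      then show ?thesis using e1 e2 by (auto simp: T_def)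
    qed
    have T: "hx e \<in> T \<longleftrightarrow> hy e \<in> T" if "e \<in> F" for e
      using T1[OF that inc_hx inc_hy] T1[OF that inc_hy inc_hx] by blast
    define h where "h = Kempe_swap F i j T f"
    have fh: "step 2 F C f h" unfolding h_def by (rule step_Kempe_swap[OF f(1) ij(1,2) T])
    have h: "factorization F C h" using fh by (simp add: step_def)
    have "nonsingular F C h = {}"
    proof -
      have "e \<notin> nonsingular F C h" if e: "e \<in> F" for e
      proof -
        have V: "hx e \<in> X \<union> Y" "hy e \<in> X \<union> Y" using hx hy FE e by auto
        \<comment> \<open>No edge leaves \<open>T\<close>, so the swap negates both turns of an edge
          or neither.\<close>
        have "turn F h i j (hx e) = turn F h i j (hy e)"
          using turn_Kempe_swap[OF f(1) C ij T V(1)] turn_Kempe_swap[OF f(1) C ij T V(2)] T[OF e]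
            nonsingular_iff[OF f(1) C ij e] f(2) unfolding h_def by blast
        then show ?thesis using nonsingular_iff[OF h C ij e] by blast
      qed
      then show ?thesis by (auto simp: nonsingular_def)
    qed
    moreover have "\<forall>e. e \<notin> F \<longrightarrow> g e = h e"
      using less.prems(3) by (simp add: h_def Kempe_swap_def)
    moreover have "card {e \<in> F. h e \<noteq> g e} < card {e \<in> F. f e \<noteq> g e}"
    proof (rule psubset_card_mono)
      show "finite {e \<in> F. f e \<noteq> g e}" using finite_subset[OF FE finE] by simp
      \<comment> \<open>Inside \<open>T\<close> an edge on which \<open>f\<close> and
        \<open>g\<close> agree has neither colour \<open>i\<close>, which is sent to
        \<open>j\<close>, nor colour \<open>j\<close>, which is already the image of
        \<open>i\<close>.\<close>
      have keep: "h e = g e" if e: "e \<in> F" "f e = g e" for e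
      proof (cases "hx e \<in> T")
        case True
        then obtain e1 where e1: "e1 \<in> F" "inc e1 (hx e)" "f e1 = i" "g e1 = j" by (auto simp: T_def)
        have "f e \<noteq> i"
          using factorization_inj[OF f(1) e(1) e1(1) inc_hx e1(2)] e e1 ij(3) by auto
        moreover have "f e \<noteq> j"
          using factorization_inj[OF g(1) e(1) e1(1) inc_hx e1(2)] e e1 ij(3) by auto
        ultimately show ?thesis using e by (simp add: h_def Kempe_swap_def Transposition.transpose_def)
      next
        case False
        then show ?thesis using e by (simp add: h_def Kempe_swap_def)
      qed
      have "hx e0 \<in> T" unfolding T_def i_def j_def using e0(1) inc_hx[of e0] by blast
      then have "h e0 = g e0" using e0 by (simp add: h_def Kempe_swap_def i_def j_def)
      then show "{e \<in> F. h e \<noteq> g e} \<subset> {e \<in> F. f e \<noteq> g e}" using keep e0 by blast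
    qed
    ultimately have "(step 2 F C)\<^sup>*\<^sup>* h g" using less.hyps h by blast
    then show ?thesis using fh by (meson converse_rtranclp_into_rtranclp)
  qed
qed

theorem cubic_Kempe_equivalent:
  assumes f: "factorization F C f" and g: "factorization F C g"
    and C: "card C = 3" and "\<forall>e. e \<notin> F \<longrightarrow> g e = f e"
  shows "(step 2 F C)\<^sup>*\<^sup>* f g"
proof -
  obtain f' where f': "(step 2 F C)\<^sup>*\<^sup>* f f'" "nonsingular F C f' = {}"
    using steps_to_singular[OF f C] by blast
  obtain g' where g': "(step 2 F C)\<^sup>*\<^sup>* g g'" "nonsingular F C g' = {}"
    using steps_to_singular[OF g C] by blast
  have "(step 2 F C)\<^sup>*\<^sup>* f' g'"
  proof (rule steps_between_singular[OF _ f'(2) _ g'(2) C])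
    show "factorization F C f'" "factorization F C g'"
      using steps_factorization f' g' f g by blast+
    show "\<forall>e. e \<notin> F \<longrightarrow> g' e = f' e"
      using steps_outside[OF f'(1)] steps_outside[OF g'(1)] assms(4) by simp
  qed
  then show ?thesis
    using f'(1) steps_sym[OF g'(1)] by (meson rtranclp_trans)
qed

text \<open>The cubic case wants exactly three colours, so a smaller set of changed colours is
  filled up from \<open>C\<close>; if \<open>C\<close> has fewer than three, the step already
  changes at most two classes.\<close>

lemma three_step_Kempe:
  assumes C: "finite C" and fg: "step 3 F C f g"
  shows "(step 2 F C)\<^sup>*\<^sup>* f g"
proof -
  obtain S where S: "S \<subseteq> C" "finite S" "card S \<le> 3" "\<forall>e\<in>F. f e \<notin> S \<or> g e \<notin> S \<longrightarrow> g e = f e"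
    using fg unfolding step_def by blast
  have f: "factorization F C f" and g: "factorization F C g" and off: "\<forall>e. e \<notin> F \<longrightarrow> g e = f e"
    using fg unfolding step_def by blast+
  show ?thesis
  proof (cases "card C \<ge> 3")
    case True
    then obtain T where T: "S \<subseteq> T" "T \<subseteq> C" "card T = 3"
      using exists_subset_between[OF S(3) _ S(1) C] by blast
    let ?F = "{e \<in> F. f e \<in> T}"
    have mem: "f e \<in> T \<longleftrightarrow> g e \<in> T" if "e \<in> F" for e
      using S(4) T(1) that by (metis subsetD)
    have eqF: "?F = {e \<in> F. g e \<in> T}" by (rule Collect_cong) (use mem in blast)
    have "(step 2 ?F T)\<^sup>*\<^sup>* f g"
    proof (rule cubic_Kempe_equivalent[OF _ _ T(3)])
      show "factorization ?F T f" by (rule factorization_restrict[OF f T(2)])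
      show "factorization ?F T g" unfolding eqF by (rule factorization_restrict[OF g T(2)])
      show "\<forall>e. e \<notin> ?F \<longrightarrow> g e = f e" using off S(4) T(1) by blast
    qed
    then show ?thesis by (rule steps_lift[OF f T(2)])
  next
    case False
    then have "card S \<le> 2" using card_mono[OF C S(1)] by linarith
    then have "step 2 F C f g" unfolding step_def using f g off S by blast
    then show ?thesis by blast
  qed
qed

theorem factorizations_Kempe_equivalent:
  assumes C: "finite C" and f: "factorization F C f" and g: "factorization F C g"
    and off: "\<forall>e. e \<notin> F \<longrightarrow> g e = f e"
  shows "(step 2 F C)\<^sup>*\<^sup>* f g"
  using three_equivalent[OF assms]
proof (induction rule: rtranclp_induct)
  case (step g h)
  then show ?case using three_step_Kempe[OF C step(2)] by (meson rtranclp_trans)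
qed simp

end

section \<open>Translation between 1-factorizations and proper colourings\<close>

lemma n_equivalent_rtranclp:
  assumes "R\<^sup>*\<^sup>* f g" "proper_coloring G t f"
    and R: "\<And>f g. R f g \<Longrightarrow> proper_coloring G t f \<Longrightarrow> proper_coloring G t g \<and> differ_at_most G t n f g"
  shows "n_equivalent G t n f g"
proof -
  obtain k where "(R ^^ k) f g" using assms(1) by (auto simp: rtranclp_power)
  then obtain H where H: "H 0 = f" "H k = g" "\<And>i. i < k \<Longrightarrow> R (H i) (H (Suc i))"
    by (auto simp: relpowp_fun_conv)
  have proper: "proper_coloring G t (H i)" if "i \<le> k" for i
    using that
  proof (induction i)
    case 0
    then show ?case using assms(2) H(1) by simp
  next
    case (Suc i)
    then have "proper_coloring G t (H i)" "R (H i) (H (Suc i))" using H(3) by simp_all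
    then show ?case using R by blast
  qed
  have differ_refl: "differ_at_most G t n f f" by (simp add: differ_at_most_def)
  show ?thesis
  proof (cases "k = 0")
    \<comment> \<open>\<open>n_equivalent\<close> demands \<open>k \<ge> 1\<close>; the empty chain
      is replaced by one idle step.\<close>
    case True
    then show ?thesis
      unfolding n_equivalent_def using H assms(2) differ_refl
      by (intro exI[of _ 1] exI[of _ "\<lambda>_. f"]) auto
  next
    case False
    then show ?thesis
      unfolding n_equivalent_def using H proper R
      by (intro exI[of _ k] exI[of _ H]) simp
  qed
qed

lemma mbipartite_bigraph:
  assumes G: "multigraph G" and "mbipartite G"
  obtains X Y hx hy where "bigraph X Y (medges G) hx hy" "X \<union> Y = mverts G"
    "\<forall>e\<in>medges G. mends G e = {hx e, hy e}"
proof -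
  obtain X Y where XY: "X \<union> Y = mverts G" "X \<inter> Y = {}"
    "\<forall>e\<in>medges G. \<exists>x\<in>X. \<exists>y\<in>Y. mends G e = {x, y}"
    using assms(2) unfolding mbipartite_def by blast
  obtain hx where "\<forall>e\<in>medges G. hx e \<in> X \<and> (\<exists>y\<in>Y. mends G e = {hx e, y})"
    using bchoice[of "medges G" "\<lambda>e x. x \<in> X \<and> (\<exists>y\<in>Y. mends G e = {x, y})"] XY(3) by blast
  moreover from this obtain hy where "\<forall>e\<in>medges G. hy e \<in> Y \<and> mends G e = {hx e, hy e}"
    using bchoice[of "medges G" "\<lambda>e y. y \<in> Y \<and> mends G e = {hx e, y}"] by blast
  ultimately have h: "\<forall>e\<in>medges G. hx e \<in> X" "\<forall>e\<in>medges G. hy e \<in> Y"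
    "\<forall>e\<in>medges G. mends G e = {hx e, hy e}" by blast+
  have "finite (X \<union> Y)" "finite (medges G)" using G XY(1) unfolding multigraph_def by simp_all
  then have "bigraph X Y (medges G) hx hy"
    using XY(2) h(1,2) by unfold_locales auto
  then show thesis using that XY(1) h(3) by blast
qed

lemma plane_drawing_plane_bigraph:
  assumes bg: "bigraph X Y (medges G) hx hy" and V: "X \<union> Y = mverts G"
    and ends: "\<forall>e\<in>medges G. mends G e = {hx e, hy e}" and pc: "plane_drawing G p c"
  shows "\<exists>d. plane_bigraph X Y (medges G) hx hy p d"
proof -
  interpret bigraph X Y "medges G" hx hy by fact
  define d where "d e = (if pathstart (c e) = p (hx e) then c e else reversepath (c e))" for e
  have inj: "inj_on p (X \<union> Y)" using pc V unfolding plane_drawing_def by simp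
  have c: "arc (c e)" "{pathstart (c e), pathfinish (c e)} = {p (hx e), p (hy e)}"
    "path_image (c e) \<inter> p ` (X \<union> Y) = {p (hx e), p (hy e)}" if "e \<in> medges G" for e
    using pc that V bspec[OF ends that] unfolding plane_drawing_def by auto
  have im: "path_image (d e) = path_image (c e)" for e by (simp add: d_def)
  have st: "pathstart (d e) = p (hx e) \<and> pathfinish (d e) = p (hy e)" if "e \<in> medges G" for e
    using c(2)[OF that] by (auto simp: d_def doubleton_eq_iff)
  have "plane_bigraph X Y (medges G) hx hy p d"
  proof
    show "inj_on p (X \<union> Y)" by fact
  next
    fix e assume e: "e \<in> medges G"
    show "arc (d e)" using c(1)[OF e] by (simp add: d_def arc_reversepath)
    show "pathstart (d e) = p (hx e)" "pathfinish (d e) = p (hy e)" using st[OF e] by blast+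
    fix v assume v: "v \<in> X \<union> Y" "p v \<in> path_image (d e)"
    then have "p v = p (hx e) \<or> p v = p (hy e)" using c(3)[OF e] im by blast
    then show "inc e v" using inj_onD[OF inj] v(1) hx[OF e] hy[OF e] unfolding inc_def by blast
  next
    fix e e' z assume e: "e \<in> medges G" "e' \<in> medges G" "e \<noteq> e'"
      and z: "z \<in> path_image (d e)" "z \<in> path_image (d e')"
    have "path_image (c e) \<inter> path_image (c e') = p ` (mends G e \<inter> mends G e')"
      using pc e unfolding plane_drawing_def by blast
    then obtain v where "z = p v" "v \<in> mends G e" "v \<in> mends G e'" using z im by blast
    moreover from this have "inc e v" "inc e' v" using ends e by (auto simp: inc_def)
    ultimately show "\<exists>v. z = p v \<and> inc e v \<and> inc e' v" by blast
  qed
  then show ?thesis by blast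
qed

lemma proper_coloring_inj_at:
  assumes "proper_coloring G t f"
  shows "inj_on f {e \<in> medges G. v \<in> mends G e}" "f ` {e \<in> medges G. v \<in> mends G e} \<subseteq> {1..t}"
  using assms unfolding proper_coloring_def inj_on_def by blast+

lemma mdegree_le_colours:
  assumes "proper_coloring G t f"
  shows "mdegree G v \<le> t"
  using card_inj_on_le[OF proper_coloring_inj_at[OF assms]] by (simp add: mdegree_def)

context
  fixes G :: "('v, 'e) mgraph" and t :: nat and X Y :: "'v set" and hx hy :: "'e \<Rightarrow> 'v"
  assumes reg: "mregular t G"
    and bg: "bigraph X Y (medges G) hx hy" and V: "X \<union> Y = mverts G"
    and ends: "\<forall>e\<in>medges G. mends G e = {hx e, hy e}"
begin

interpretation bigraph X Y "medges G" hx hy by (fact bg)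

lemma inc_iff_ends: "e \<in> medges G \<Longrightarrow> inc e v \<longleftrightarrow> v \<in> mends G e"
  using ends by (auto simp: inc_def)

lemma edges_at: "{e \<in> medges G. inc e v} = {e \<in> medges G. v \<in> mends G e}"
  using inc_iff_ends by blast

lemma deg_regular: "v \<in> X \<union> Y \<Longrightarrow> deg (medges G) v = t"
  using reg V unfolding mregular_def mdegree_def deg_def edges_at by blast

text \<open>The \<open>t\<close> edges at a vertex have distinct colours out of \<open>t\<close>, so
  no colour is missing there.\<close>

lemma proper_coloring_factorization:
  assumes f: "proper_coloring G t f"
  shows "factorization (medges G) {1..t} f"
  unfolding factorization_def
proof (intro conjI ballI)
  show "f ` medges G \<subseteq> {1..t}" using f unfolding proper_coloring_def by blast
  fix v c assume v: "v \<in> X \<union> Y" and c: "c \<in> {1..t}"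
  let ?A = "{e \<in> medges G. v \<in> mends G e}"
  have "card ?A = t" using deg_regular[OF v] unfolding deg_def edges_at .
  then have "f ` ?A = {1..t}"
    using proper_coloring_inj_at[OF f, of v] by (intro card_subset_eq) (auto simp: card_image)
  then have "c \<in> f ` ?A" using c by (simp only:)
  then obtain e where e: "e \<in> ?A" "f e = c" by (rule imageE) simp
  show "\<exists>!e. e \<in> medges G \<and> inc e v \<and> f e = c"
  proof (rule ex1I[of _ e])
    show "e \<in> medges G \<and> inc e v \<and> f e = c" using e inc_iff_ends by blast
    fix e' assume e': "e' \<in> medges G \<and> inc e' v \<and> f e' = c"
    then have "e' \<in> ?A" using inc_iff_ends by blast
    then show "e' = e"
      using inj_onD[OF proper_coloring_inj_at(1)[OF f, of v], of e' e] e e' by simp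
  qed
qed simp

lemma factorization_proper_coloring:
  assumes f: "factorization (medges G) {1..t} f" and ext: "f \<in> extensional (medges G)"
  shows "proper_coloring G t f"
  unfolding proper_coloring_def
proof (intro conjI ballI impI)
  show "f \<in> medges G \<rightarrow>\<^sub>E {1..t}" using f ext by (auto simp: factorization_def PiE_def)
  fix e e' assume e: "e \<in> medges G" "e' \<in> medges G" "e \<noteq> e' \<and> mends G e \<inter> mends G e' \<noteq> {}"
  then obtain v where "v \<in> mends G e" "v \<in> mends G e'" by blast
  then show "f e \<noteq> f e'" using factorization_inj[OF f e(1,2), of v] e inc_iff_ends by blast
qed

lemma step_differ_at_most:
  assumes "step n (medges G) {1..t} f g"
  shows "differ_at_most G t n f g"
proof -
  obtain S where S: "finite S" "card S \<le> n" "\<forall>e\<in>medges G. f e \<notin> S \<or> g e \<notin> S \<longrightarrow> g e = f e"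
    using assms unfolding step_def by blast
  have "color_class G f j = color_class G g j" if "j \<notin> S" for j
    using S(3) that unfolding color_class_def by (intro Collect_cong) metis
  then have "{j \<in> {1..t}. color_class G f j \<noteq> color_class G g j} \<subseteq> S" by blast
  then show ?thesis unfolding differ_at_most_def using card_mono[OF S(1)] S(2) by (meson le_trans)
qed

lemma steps_n_equivalent:
  assumes "(step n (medges G) {1..t})\<^sup>*\<^sup>* f g" and f: "proper_coloring G t f"
  shows "n_equivalent G t n f g"
proof (rule n_equivalent_rtranclp[OF assms])
  fix f g assume s: "step n (medges G) {1..t} f g" and f: "proper_coloring G t f"
  have "f \<in> extensional (medges G)" using f unfolding proper_coloring_def PiE_def by blast
  moreover have "\<forall>e. e \<notin> medges G \<longrightarrow> g e = f e" "factorization (medges G) {1..t} g"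
    using s unfolding step_def by blast+
  ultimately show "proper_coloring G t g \<and> differ_at_most G t n f g"
    using factorization_proper_coloring[of g] step_differ_at_most[OF s] by (simp add: extensional_def)
qed

lemma proper_coloring_exists: "\<exists>f. proper_coloring G t f"
proof -
  obtain f where f: "factorization (medges G) {1..t} f"
    using regular_factorization_exists[of "{1..t}" "medges G"] deg_regular by auto
  have "factorization (medges G) {1..t} (restrict f (medges G))"
    by (rule factorization_cong[OF f]) simp
  then show ?thesis using factorization_proper_coloring by blast
qed

text \<open>The degree at some vertex is the lower bound; without vertices the index would be 0
  whatever \<open>t\<close> is.\<close>

lemma chromatic_index_regular:
  assumes "mverts G \<noteq> {}"
  shows "chromatic_index G = t"
  unfolding chromatic_index_def
proof (rule Least_equality)
  show "\<exists>f. proper_coloring G t f" by (rule proper_coloring_exists)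
  fix s assume "\<exists>f. proper_coloring G s f"
  then obtain f where f: "proper_coloring G s f" by blast
  obtain v where "v \<in> mverts G" using assms by blast
  then show "t \<le> s" using mdegree_le_colours[OF f, of v] reg unfolding mregular_def by simp
qed

end

theorem corollary4p4:
  fixes G :: "('v, 'e) mgraph" and t :: nat
  assumes "multigraph G"
    and "t \<ge> 2"
    and "mregular t G"
    and "mplanar G"
    and "mbipartite G"
  shows "chi_trans G = 2 \<and>
    (\<forall>f g. proper_coloring G t f \<and> proper_coloring G t g \<longrightarrow> Kempe_equivalent G t f g)"
proof -
  obtain X Y hx hy where bg: "bigraph X Y (medges G) hx hy" and V: "X \<union> Y = mverts G"
    and ends: "\<forall>e\<in>medges G. mends G e = {hx e, hy e}"
    using mbipartite_bigraph[OF assms(1,5)] by blast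
  obtain p c where "plane_drawing G p c" using assms(4) unfolding mplanar_def by blast
  then obtain d where "plane_bigraph X Y (medges G) hx hy p d"
    using plane_drawing_plane_bigraph[OF bg V ends] by blast
  then interpret plane_bigraph X Y "medges G" hx hy p d .
  have Kempe: "Kempe_equivalent G t f g" if f: "proper_coloring G t f" and g: "proper_coloring G t g" for f g
  proof -
    have "f \<in> extensional (medges G)" "g \<in> extensional (medges G)"
      using f g unfolding proper_coloring_def PiE_def by blast+
    then have "(step 2 (medges G) {1..t})\<^sup>*\<^sup>* f g"
      using f g proper_coloring_factorization[OF assms(3) bg V ends]
      by (intro factorizations_Kempe_equivalent) (auto simp: extensional_def)
    then show ?thesis using steps_n_equivalent[OF assms(3) bg V ends] f by blast
  qed
  have "n_equivalent G (chromatic_index G) 2 f g"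
    if f: "proper_coloring G (chromatic_index G) f" and g: "proper_coloring G (chromatic_index G) g" for f g
  proof (cases "mverts G = {}")
    \<comment> \<open>Here the index is 0 instead of \<open>t\<close>; but without edges there is
      only one extensional function, hence only one colouring.\<close>
    case True
    then have "medges G = {}" using assms(1) unfolding multigraph_def by force
    then have "f = g" using f g unfolding proper_coloring_def by auto
    then show ?thesis using n_equivalent_rtranclp[of "\<lambda>_ _. False" f g] f by blast
  next
    case False
    then have "chromatic_index G = t" by (rule chromatic_index_regular[OF assms(3) bg V ends])
    then show ?thesis using Kempe f g by simp
  qed
  then have "chi_trans G = 2"
    unfolding chi_trans_def by (intro Least_equality) auto
  then show ?thesis using Kempe by blast
qed

end
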